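(* Let $R$ be an irreducible, reduced root system of dimension $n$ and, for $\tau\in\mathbb H_1$, let $A_\tau$ be the principally polarized abelian variety with Riemann matrix $Z_\tau=\tau Z_0$, where $Z_0$ is the matrix attached to $R$. Then each $A_\tau$ is isomorphic, as a complex torus, to a product of elliptic curves as follows: $R=\mathbf{A_n}$ (any $n$): $E_\tau^{n-1}\times E_{\tau/(n+1)}$; $R=\mathbf{B_n}$ (any $n$): $E_\tau^{n}$; $R=\mathbf{C_n}$ or $\mathbf{D_n}$: $E_\tau^{n-1}\times E_{\tau/4}$ if $n$ is odd, and $E_\tau^{n-2}\times E_{\tau/2}^{2}$ if $n$ is even; $R=\mathbf{E_6}$: $E_\tau^5\times E_{\tau/3}$; $R=\mathbf{E_7}$: $E_\tau^6\times E_{\tau/2}$; $R=\mathbf{E_8}$: $E_\tau^8$; $R=\mathbf{F_4}$: $E_\tau^2\times E_{\tau/2}^2$; $R=\mathbf{G_2}$: $E_\tau\times E_{\tau/3}$.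
   Context: $E_\mu=\mathbb C/(\mathbb Z+\mu\mathbb Z)$ for $\mu\in\mathbb H_1$ (upper half plane). The p.p.a.v. (principally polarized abelian variety) with Riemann matrix $Z$ in the Siegel upper half space $\mathbb H_n$ is the complex torus $\mathbb C^n/(\mathbb Z^n+Z\mathbb Z^n)$ with its standard principal polarization. The irreducible reduced root systems are $\mathbf{A_n}$ ($n\ge1$), $\mathbf{B_n}$ ($n\ge2$), $\mathbf{C_n}$ ($n\ge3$), $\mathbf{D_n}$ ($n\ge3$), $\mathbf{E_6},\mathbf{E_7},\mathbf{E_8},\mathbf{F_4},\mathbf{G_2}$, with simple roots numbered as in Bourbaki. The symmetric matrix $Z_0$ attached to $R$ is: $\mathbf{A_n}$: $(Z_0)_{ij}=\frac{i(n+1-j)}{n+1}$ for $i\le j$. $\mathbf{B_n}$: $(Z_0)_{ij}=\min(i,j)$. $\mathbf{C_n}$: $(Z_0)_{ij}=\min(i,j)$ for $i,j\le n-1$; $(Z_0)_{in}=\frac i2$ for $i\le n-1$; $(Z_0)_{nn}=\frac n4$. $\mathbf{D_n}$: $(Z_0)_{ij}=\min(i,j)$ for $i,j\le n-2$; $(Z_0)_{i,n-1}=(Z_0)_{in}=\frac i2$ for $i\le n-2$; $(Z_0)_{n-1,n-1}=(Z_0)_{nn}=\frac n4$; $(Z_0)_{n-1,n}=\frac{n-2}4$. $\mathbf{E_k}$, $k=6,7,8$: $Z_0$ is the inverse of the Cartan matrix, which has $2$ on the diagonal, $-1$ at positions $(i,j)$ and $(j,i)$ for the edges $\{1,3\},\{2,4\},\{3,4\},\{4,5\},\dots,\{k-1,k\}$,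 and $0$ elsewhere. $\mathbf{F_4}$: $Z_0=\begin{pmatrix}1&\frac32&2&1\\\frac32&3&4&2\\2&4&6&3\\1&2&3&2\end{pmatrix}$. $\mathbf{G_2}$: $Z_0=\frac13\begin{pmatrix}6&3\\3&2\end{pmatrix}$. *)

theory Defs
  imports "HOL-Analysis.Analysis" "HOL-Algebra.Product_Groups"
begin

text \<open>
  A complex torus is a group together with its uniformization, i.e. the quotient
  map from its universal cover. The complex manifold structure is the one for
  which the uniformization is locally biholomorphic.
\<close>

record ('v, 'a) complex_torus = "'a monoid" +
  uniformization :: "'v \<Rightarrow> 'a"

definition additive_group :: "'v::ab_group_add monoid" where
  "additive_group = \<lparr>carrier = UNIV, monoid.mult = (+), one = 0\<rparr>"

definition quotient_torus :: "'v::ab_group_add set \<Rightarrow> ('v, 'v set) complex_torus" where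
  "quotient_torus L = monoid.extend (additive_group Mod L)
     (complex_torus.fields (\<lambda>z. L #>\<^bsub>additive_group\<^esub> z))"

definition elliptic_curve :: "complex \<Rightarrow> (complex, complex set) complex_torus" where
  "elliptic_curve \<mu> = quotient_torus {of_int a + of_int b * \<mu> | a b. True}"

definition product_torus ::
    "('n::finite \<Rightarrow> (complex, 'a) complex_torus) \<Rightarrow> (complex^'n, 'n \<Rightarrow> 'a) complex_torus" where
  "product_torus T = monoid.extend (product_group UNIV T)
     (complex_torus.fields (\<lambda>z i. uniformization (T i) (z $ i)))"

definition complex_linear :: "(complex^'n \<Rightarrow> complex^'m) \<Rightarrow> bool" where
  "complex_linear D \<longleftrightarrow>
     (\<forall>v w. D (v + w) = D v + D w) \<and> (\<forall>c v. D (c *s v) = c *s D v)"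

definition holomorphic_vec_on ::
    "(complex^'n \<Rightarrow> complex^'m) \<Rightarrow> (complex^'n) set \<Rightarrow> bool" where
  "holomorphic_vec_on F U \<longleftrightarrow>
     (\<forall>w\<in>U. \<exists>D. (F has_derivative D) (at w) \<and> complex_linear D)"

text \<open>
  Local inverses of the uniformizations are the charts, so a map of tori is
  holomorphic iff it lifts locally to a holomorphic map of the covering spaces.
\<close>

definition torus_holomorphic ::
    "(complex^'n, 'a, 'c) complex_torus_scheme \<Rightarrow> (complex^'m, 'b, 'd) complex_torus_scheme \<Rightarrow>
     ('a \<Rightarrow> 'b) \<Rightarrow> bool" where
  "torus_holomorphic S T f \<longleftrightarrow>
     (\<forall>z. \<exists>U F. open U \<and> z \<in> U \<and> holomorphic_vec_on F U \<and>
        (\<forall>w\<in>U. f (uniformization S w) = uniformization T (F w)))"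

definition isomorphic_tori ::
    "(complex^'n, 'a, 'c) complex_torus_scheme \<Rightarrow> (complex^'m, 'b, 'd) complex_torus_scheme \<Rightarrow>
     bool" where
  "isomorphic_tori S T \<longleftrightarrow>
     (\<exists>f\<in>iso S T. torus_holomorphic S T f \<and>
        torus_holomorphic T S (inv_into (carrier S) f))"

definition siegel_upper_half_space :: "(complex^'n^'n) set" where
  "siegel_upper_half_space =
     {Z. transpose Z = Z \<and>
         (\<forall>x::real^'n. x \<noteq> 0 \<longrightarrow> x \<bullet> ((\<chi> i j. Im (Z $ i $ j)) *v x) > 0)}"

definition riemann_lattice :: "complex^'n^'n \<Rightarrow> (complex^'n) set" where
  "riemann_lattice Z =
     {(\<chi> i. of_int (a $ i)) + Z *v (\<chi> i. of_int (b $ i)) | (a :: int^'n) (b :: int^'n). True}"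

record ('v, 'a) ppav = "('v, 'a) complex_torus" +
  polarization :: "'v \<Rightarrow> 'v \<Rightarrow> complex"

text \<open>
  A polarization is given by its Hermitian form on the universal cover. The
  standard principal one for \<open>Z = X + \<i>Y\<close> is \<open>H(v, w) = v\<^sup>T Y\<^sup>-\<^sup>1 w\<^sup>*\<close>, with \<open>w\<^sup>*\<close> the complex
  conjugate: its imaginary part takes the value \<open>a\<^sup>T b\<close> on \<open>(Z a, b)\<close> and vanishes
  on pairs of integer vectors and on pairs \<open>(Z a, Z b)\<close>.
\<close>

definition ppav_of :: "complex^'n^'n \<Rightarrow> (complex^'n, (complex^'n) set) ppav" where
  "ppav_of Z = complex_torus.extend (quotient_torus (riemann_lattice Z))
     (ppav.fields (\<lambda>v w. \<Sum>i\<in>UNIV. \<Sum>j\<in>UNIV.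
        v $ i * of_real (matrix_inv (\<chi> k l. Im (Z $ k $ l)) $ i $ j) * cnj (w $ j)))"

datatype root_system = An nat | Bn nat | Cn nat | Dn nat | E6 | E7 | E8 | F4 | G2

fun root_system_dim :: "root_system \<Rightarrow> nat" where
  "root_system_dim (An n) = n"
| "root_system_dim (Bn n) = n"
| "root_system_dim (Cn n) = n"
| "root_system_dim (Dn n) = n"
| "root_system_dim E6 = 6"
| "root_system_dim E7 = 7"
| "root_system_dim E8 = 8"
| "root_system_dim F4 = 4"
| "root_system_dim G2 = 2"

fun valid_root_system :: "root_system \<Rightarrow> bool" where
  "valid_root_system (An n) \<longleftrightarrow> n \<ge> 1"
| "valid_root_system (Bn n) \<longleftrightarrow> n \<ge> 2"
| "valid_root_system (Cn n) \<longleftrightarrow> n \<ge> 3"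
| "valid_root_system (Dn n) \<longleftrightarrow> n \<ge> 3"
| "valid_root_system _ \<longleftrightarrow> True"

text \<open>
  Coordinates are indexed by an arbitrary finite linear order \<open>'n\<close>, and \<open>pos i\<close> is
  the number from 1 to \<open>CARD('n)\<close> of the coordinate \<open>i\<close>.
\<close>

definition pos :: "'n::{finite,linorder} \<Rightarrow> nat" where
  "pos i = card {j. j \<le> i}"

definition matrix_of :: "(nat \<Rightarrow> nat \<Rightarrow> 'a) \<Rightarrow> 'a^'n::{finite,linorder}^'n::{finite,linorder}" where
  "matrix_of M = (\<chi> i j. M (pos i) (pos j))"

text \<open>For a symmetric matrix of which only the entries \<open>(i, j)\<close> with \<open>i \<le> j\<close> are specified.\<close>

definition symmetrize :: "(nat \<Rightarrow> nat \<Rightarrow> 'a) \<Rightarrow> nat \<Rightarrow> nat \<Rightarrow> 'a" where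
  "symmetrize M i j = M (min i j) (max i j)"

text \<open>
  The matrices for \<open>E6\<close>, \<open>E7\<close>, \<open>E8\<close> are the leading 6-, 7- and 8-dimensional
  blocks of this one.
\<close>

definition cartan_E :: "nat \<Rightarrow> nat \<Rightarrow> real" where
  "cartan_E = symmetrize (\<lambda>i j.
     if i = j then 2
     else if (i, j) \<in> {(1, 3), (2, 4)} \<or> (3 \<le> i \<and> j = i + 1) then - 1
     else 0)"

definition matrix_F4 :: "real list list" where
  "matrix_F4 = [[1, 3/2, 2, 1], [3/2, 3, 4, 2], [2, 4, 6, 3], [1, 2, 3, 2]]"

definition matrix_G2 :: "real list list" where
  "matrix_G2 = [[6/3, 3/3], [3/3, 2/3]]"

fun Z0 :: "root_system \<Rightarrow> real^'n::{finite,linorder}^'n::{finite,linorder}" where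
  "Z0 (An n) = matrix_of (symmetrize (\<lambda>i j. real i * (real n + 1 - real j) / (real n + 1)))"
| "Z0 (Bn n) = matrix_of (\<lambda>i j. real (min i j))"
| "Z0 (Cn n) = matrix_of (symmetrize (\<lambda>i j.
     if j \<le> n - 1 then real i
     else if i \<le> n - 1 then real i / 2
     else real n / 4))"
| "Z0 (Dn n) = matrix_of (symmetrize (\<lambda>i j.
     if j \<le> n - 2 then real i
     else if i \<le> n - 2 then real i / 2
     else if i = j then real n / 4
     else (real n - 2) / 4))"
| "Z0 E6 = matrix_inv (matrix_of cartan_E)"
| "Z0 E7 = matrix_inv (matrix_of cartan_E)"
| "Z0 E8 = matrix_inv (matrix_of cartan_E)"
| "Z0 F4 = matrix_of (\<lambda>i j. matrix_F4 ! (i - 1) ! (j - 1))"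
| "Z0 G2 = matrix_of (\<lambda>i j. matrix_G2 ! (i - 1) ! (j - 1))"

definition riemann_matrix :: "root_system \<Rightarrow> complex \<Rightarrow> complex^'n::{finite,linorder}^'n::{finite,linorder}" where
  "riemann_matrix R \<tau> = (\<chi> i j. \<tau> * of_real (Z0 R $ i $ j))"

definition product_of_elliptic_curves ::
    "complex list \<Rightarrow> (complex^'n::{finite,linorder}, 'n::{finite,linorder} \<Rightarrow> complex set) complex_torus" where
  "product_of_elliptic_curves \<mu>s = product_torus (\<lambda>i. elliptic_curve (\<mu>s ! (pos i - 1)))"

fun elliptic_moduli :: "root_system \<Rightarrow> complex \<Rightarrow> complex list" where
  "elliptic_moduli (An n) \<tau> = replicate (n - 1) \<tau> @ [\<tau> / of_nat (n + 1)]"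
| "elliptic_moduli (Bn n) \<tau> = replicate n \<tau>"
| "elliptic_moduli (Cn n) \<tau> =
     (if odd n then replicate (n - 1) \<tau> @ [\<tau> / 4] else replicate (n - 2) \<tau> @ [\<tau> / 2, \<tau> / 2])"
| "elliptic_moduli (Dn n) \<tau> =
     (if odd n then replicate (n - 1) \<tau> @ [\<tau> / 4] else replicate (n - 2) \<tau> @ [\<tau> / 2, \<tau> / 2])"
| "elliptic_moduli E6 \<tau> = replicate 5 \<tau> @ [\<tau> / 3]"
| "elliptic_moduli E7 \<tau> = replicate 6 \<tau> @ [\<tau> / 2]"
| "elliptic_moduli E8 \<tau> = replicate 8 \<tau>"
| "elliptic_moduli F4 \<tau> = [\<tau>, \<tau>, \<tau> / 2, \<tau> / 2]"
| "elliptic_moduli G2 \<tau> = [\<tau>, \<tau> / 3]"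

end

theory Submission
  imports Defs
begin

text \<open>
  The Riemann matrix is \<open>\<tau>\<close> times a real matrix \<open>A\<close>. If \<open>A = P D Q\<close> with \<open>P\<close>, \<open>Q\<close> invertible over the
  integers and \<open>D\<close> diagonal with entries \<open>d\<^sub>k\<close>, then multiplication by \<open>P\<^sup>-\<^sup>1\<close> maps \<open>\<int>\<^sup>n + \<tau> A \<int>\<^sup>n\<close> onto
  \<open>\<int>\<^sup>n + \<tau> D \<int>\<^sup>n\<close>, which is the product of the lattices \<open>\<int> + \<tau> d\<^sub>k \<int>\<close>. So the torus is the product of
  the elliptic curves with moduli \<open>\<tau> d\<^sub>k\<close>; this is \<open>isomorphic_tori_of_diagonalizes\<close>. As
  \<open>Im (\<tau> A) = Im \<tau> A\<close>, membership in the Siegel half space amounts to positive definiteness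
  of \<open>A\<close>. What remains is such a factorization of each matrix, with explicit \<open>P\<close> and \<open>Q\<close>.

  The matrices are Gram matrices of bases of lattices \<open>\<Lambda>\<close>, and a factorization \<open>P D Q\<close> is the same as
  a basis \<open>\<lambda>\<^sub>1, \<dots>, \<lambda>\<^sub>n\<close> of \<open>\<Lambda>\<close> such that the vectors \<open>\<lambda>\<^sub>k / d\<^sub>k\<close> form a basis of the dual lattice of \<open>\<Lambda>\<close>:
  \<open>Q\<close> contains the coordinates of the original basis in terms of the \<open>\<lambda>\<^sub>k\<close>, and \<open>P\<close> pairs the
  original basis with the \<open>\<lambda>\<^sub>k / d\<^sub>k\<close>. For \<open>A\<^sub>n\<close> and \<open>E\<^sub>n\<close>, where \<open>\<Lambda>\<close> is the weight lattice, its
  quotient by the root lattice is cyclic, so all but one \<open>\<lambda>\<^sub>k\<close> can lie in the root lattice; simple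
  roots turn out to work for them. For \<open>C\<^sub>n\<close> and \<open>D\<^sub>n\<close>
  both Gram matrices belong to \<open>\<Lambda> = \<int>\<^sup>n + \<int> (1/2, \<dots>, 1/2)\<close>, whose dual is the lattice of integer vectors
  with even coordinate sum; the quotient is cyclic of order 4 for odd \<open>n\<close> and a Klein four-group
  for even \<open>n\<close>, which explains the case distinction. In most cases \<open>P\<close> and \<open>Q\<close> are seen to be
  invertible by elimination with unit pivots, in \<open>unimodular_pivots\<close>.
\<close>

section \<open>Splitting a torus\<close>

lemma group_additive_group: "group (additive_group :: 'v::ab_group_add monoid)"
proof (rule groupI)
  fix x :: 'v
  show "\<exists>y\<in>carrier additive_group. y \<otimes>\<^bsub>additive_group\<^esub> x = \<one>\<^bsub>additive_group\<^esub>"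
    by (rule bexI[of _ "- x"]) (auto simp: additive_group_def)
qed (auto simp: additive_group_def add.assoc)

lemma comm_group_additive_group: "comm_group (additive_group :: 'v::ab_group_add monoid)"
  by (rule group.group_comm_groupI[OF group_additive_group])
     (simp add: additive_group_def add.commute)

lemma inv_additive_group: "inv\<^bsub>additive_group\<^esub> x = - x"
  by (rule group.inv_equality[OF group_additive_group]) (auto simp: additive_group_def)

lemma normal_additive_group:
  assumes "0 \<in> L" "\<And>v w. v \<in> L \<Longrightarrow> w \<in> L \<Longrightarrow> v + w \<in> L" "\<And>v. v \<in> L \<Longrightarrow> - v \<in> L"
  shows "L \<lhd> additive_group"
proof -
  have "subgroup L additive_group"
  proof (rule group.subgroupI[OF group_additive_group])
    show "inv\<^bsub>additive_group\<^esub> v \<in> L" if "v \<in> L" for v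
      unfolding inv_additive_group using assms(3) that .
  qed (use assms(1,2) in \<open>auto simp: additive_group_def\<close>)
  then show ?thesis
    by (rule comm_group.subgroup_imp_normal[OF comm_group_additive_group])
qed

text \<open>
  The first isomorphism theorem, with the analytic structure carried along: a linear
  isomorphism of the covering spaces that induces a surjection with kernel \<open>L\<close> descends to the
  quotient, and it is itself a global holomorphic lift of the induced map.
\<close>

lemma isomorphic_tori_quotientI:
  fixes \<Phi> :: "complex^'n \<Rightarrow> complex^'m" and \<Psi> :: "complex^'m \<Rightarrow> complex^'n"
    and S :: "(complex^'n, (complex^'n) set, 'c) complex_torus_scheme"
    and T :: "(complex^'m, 'b, 'd) complex_torus_scheme"
  assumes S: "carrier S = carrier (additive_group Mod L)"
      "monoid.mult S = monoid.mult (additive_group Mod L)"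
      "uniformization S = (\<lambda>z. L #>\<^bsub>additive_group\<^esub> z)"
    and T: "group T" "range (uniformization T) = carrier T"
      "\<And>v w. uniformization T (v + w) = uniformization T v \<otimes>\<^bsub>T\<^esub> uniformization T w"
    and \<Phi>: "bounded_linear \<Phi>" "complex_linear \<Phi>" and \<Psi>: "bounded_linear \<Psi>" "complex_linear \<Psi>"
    and inverse: "\<And>z. \<Psi> (\<Phi> z) = z" "\<And>w. \<Phi> (\<Psi> w) = w"
    and L: "\<And>z. z \<in> L \<longleftrightarrow> uniformization T (\<Phi> z) = \<one>\<^bsub>T\<^esub>"
  shows "isomorphic_tori S T"
proof -
  define h where "h z = uniformization T (\<Phi> z)" for z
  interpret G: group "additive_group :: (complex^'n) monoid" by (rule group_additive_group)
  interpret T: group T by (rule T(1))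
  have h_add: "h (v + w) = h v \<otimes>\<^bsub>T\<^esub> h w" for v w
    using \<Phi>(2) T(3) unfolding h_def complex_linear_def by simp
  have h_closed: "h z \<in> carrier T" for z
    using T(2) unfolding h_def by blast
  interpret h: group_hom additive_group T h
    by unfold_locales (auto simp: hom_def additive_group_def h_add h_closed)
  have kernel: "kernel additive_group T h = L"
    unfolding kernel_def using L by (auto simp: h_def additive_group_def)
  have image: "h ` carrier additive_group = carrier T"
  proof -
    have "surj \<Phi>" using inverse(2) by (rule surjI)
    then have "range h = range (uniformization T)"
      unfolding h_def by (metis image_image)
    then show ?thesis using T(2) by (simp add: additive_group_def)
  qed
  define f where "f X = the_elem (h ` X)" for X
  have f_iso: "f \<in> iso S T"
    using h.FactGroup_iso_set[OF image] S
    unfolding kernel f_def[symmetric] iso_def hom_def by simp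
  have coset: "L #>\<^bsub>additive_group\<^esub> z = (\<lambda>l. l + z) ` L" for z
    unfolding r_coset_def additive_group_def by auto
  have f_coset: "f (uniformization S z) = h z" for z
  proof -
    have one: "h l = \<one>\<^bsub>T\<^esub>" if "l \<in> L" for l
      using that L unfolding h_def by blast
    have "h ` ((\<lambda>l. l + z) ` L) = {h z}"
    proof -
      have "0 \<in> L" using h.hom_one L unfolding h_def additive_group_def by simp
      then show ?thesis using one h_closed by (force simp: h_add)
    qed
    then show ?thesis unfolding f_def S(3) coset by simp
  qed
  have S_carrier: "uniformization S z \<in> carrier S" for z
    unfolding S FactGroup_def RCOSETS_def additive_group_def by auto
  have f_inverse: "inv_into (carrier S) f (uniformization T w) = uniformization S (\<Psi> w)" for w
  proof (rule inv_into_f_eq)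
    show "inj_on f (carrier S)" using f_iso by (simp add: iso_def bij_betw_def)
    show "uniformization S (\<Psi> w) \<in> carrier S" by (rule S_carrier)
    show "f (uniformization S (\<Psi> w)) = uniformization T w"
      unfolding f_coset h_def inverse ..
  qed
  have "torus_holomorphic S T f"
    unfolding torus_holomorphic_def holomorphic_vec_on_def
    using f_coset \<Phi> bounded_linear_imp_has_derivative[OF \<Phi>(1)] h_def
    by (intro allI exI[of _ UNIV] exI[of _ \<Phi>]) auto
  moreover have "torus_holomorphic T S (inv_into (carrier S) f)"
    unfolding torus_holomorphic_def holomorphic_vec_on_def
    using f_inverse \<Psi> bounded_linear_imp_has_derivative[OF \<Psi>(1)]
    by (intro allI exI[of _ UNIV] exI[of _ \<Psi>]) auto
  ultimately show ?thesis
    unfolding isomorphic_tori_def using f_iso by blast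
qed

definition elliptic_lattice :: "complex \<Rightarrow> complex set" where
  "elliptic_lattice \<mu> = {of_int a + of_int b * \<mu> | a b. True}"

lemma normal_elliptic_lattice: "elliptic_lattice \<mu> \<lhd> additive_group"
proof (rule normal_additive_group)
  have "(0::complex) = of_int 0 + of_int 0 * \<mu>" by simp
  then show "0 \<in> elliptic_lattice \<mu>" unfolding elliptic_lattice_def by blast
next
  fix v w assume "v \<in> elliptic_lattice \<mu>" "w \<in> elliptic_lattice \<mu>"
  then obtain a b c d where "v = of_int a + of_int b * \<mu>" "w = of_int c + of_int d * \<mu>"
    unfolding elliptic_lattice_def by blast
  then have "v + w = of_int (a + c) + of_int (b + d) * \<mu>" by (simp add: algebra_simps)
  then show "v + w \<in> elliptic_lattice \<mu>" unfolding elliptic_lattice_def by blast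
next
  fix v assume "v \<in> elliptic_lattice \<mu>"
  then obtain a b where "v = of_int a + of_int b * \<mu>"
    unfolding elliptic_lattice_def by blast
  then have "- v = of_int (- a) + of_int (- b) * \<mu>" by simp
  then show "- v \<in> elliptic_lattice \<mu>" unfolding elliptic_lattice_def by blast
qed

lemma group_cong:
  assumes "group G" "carrier H = carrier G" "monoid.mult H = monoid.mult G" "one H = one G"
  shows "group H"
  using assms unfolding group_def group_axioms_def monoid_def Units_def by simp

lemma quotient_torus_simps [simp]:
  "carrier (quotient_torus L) = carrier (additive_group Mod L)"
  "monoid.mult (quotient_torus L) = monoid.mult (additive_group Mod L)"
  "one (quotient_torus L) = one (additive_group Mod L)"
  "uniformization (quotient_torus L) = (\<lambda>z. L #>\<^bsub>additive_group\<^esub> z)"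
  by (simp_all add: quotient_torus_def monoid.defs complex_torus.defs)

lemma elliptic_curve_eq: "elliptic_curve \<mu> = quotient_torus (elliptic_lattice \<mu>)"
  by (simp add: elliptic_curve_def elliptic_lattice_def)

lemma group_elliptic_curve: "group (elliptic_curve \<mu>)"
  unfolding elliptic_curve_eq
  by (rule group_cong[OF normal.factorgroup_is_group[OF normal_elliptic_lattice]]) simp_all

lemma uniformization_elliptic_curve_add:
  "uniformization (elliptic_curve \<mu>) (v + w) =
     uniformization (elliptic_curve \<mu>) v \<otimes>\<^bsub>elliptic_curve \<mu>\<^esub> uniformization (elliptic_curve \<mu>) w"
  using normal.rcos_sum[OF normal_elliptic_lattice, of v w]
  by (simp add: elliptic_curve_eq FactGroup_def additive_group_def)

lemma range_uniformization_elliptic_curve: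
  "range (uniformization (elliptic_curve \<mu>)) = carrier (elliptic_curve \<mu>)"
  by (auto simp: elliptic_curve_eq FactGroup_def RCOSETS_def additive_group_def)

lemma uniformization_elliptic_curve_eq_one:
  "uniformization (elliptic_curve \<mu>) z = \<one>\<^bsub>elliptic_curve \<mu>\<^esub> \<longleftrightarrow> z \<in> elliptic_lattice \<mu>"
proof -
  interpret group "additive_group :: complex monoid" by (rule group_additive_group)
  have L: "subgroup (elliptic_lattice \<mu>) additive_group"
    by (rule normal_imp_subgroup[OF normal_elliptic_lattice])
  have "elliptic_lattice \<mu> #>\<^bsub>additive_group\<^esub> z = elliptic_lattice \<mu> \<longleftrightarrow> z \<in> elliptic_lattice \<mu>"
    using coset_join1[OF _ _ L, of z] coset_join2[OF _ L, of z]
    by (auto simp: additive_group_def)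
  then show ?thesis
    by (simp add: elliptic_curve_eq FactGroup_def)
qed

lemma product_torus_simps [simp]:
  "carrier (product_torus T) = carrier (product_group UNIV T)"
  "monoid.mult (product_torus T) = monoid.mult (product_group UNIV T)"
  "one (product_torus T) = one (product_group UNIV T)"
  "uniformization (product_torus T) = (\<lambda>z i. uniformization (T i) (z $ i))"
  by (simp_all add: product_torus_def monoid.defs complex_torus.defs)

lemma group_product_torus:
  assumes "\<And>i. group (T i)"
  shows "group (product_torus T)"
  by (rule group_cong[OF product_group[of UNIV T, OF assms]]) simp_all

lemma range_uniformization_product_torus:
  assumes "\<And>i. range (uniformization (T i)) = carrier (T i)"
  shows "range (uniformization (product_torus T)) = carrier (product_torus T)"
proof (intro equalityI subsetI)
  fix g assume "g \<in> range (uniformization (product_torus T))"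
  then show "g \<in> carrier (product_torus T)" using assms by fastforce
next
  fix g assume "g \<in> carrier (product_torus T)"
  then have "\<exists>z. g i = uniformization (T i) z" for i
    using assms[of i] by (auto simp: PiE_iff)
  then obtain z where "\<And>i. g i = uniformization (T i) (z i)" by metis
  then have "g = uniformization (product_torus T) (\<chi> i. z i)" by auto
  then show "g \<in> range (uniformization (product_torus T))" by blast
qed

text \<open>
  A product of elliptic curves is uniformized componentwise, so the kernel of its uniformization is
  the product of the lattices \<open>\<int> + \<mu>\<^sub>i \<int>\<close>. The linear map \<open>W\<close>, with inverse \<open>V\<close>, therefore only has to
  match the lattices.
\<close>

lemma isomorphic_tori_product_of_elliptic_curvesI:
  fixes V W :: "complex^'n::{finite,linorder}^'n::{finite,linorder}"
  assumes "V ** W = mat 1" "W ** V = mat 1"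
    and "\<And>z. z \<in> riemann_lattice Z \<longleftrightarrow> (\<forall>i. (W *v z) $ i \<in> elliptic_lattice (\<mu>s ! (pos i - 1)))"
  shows "isomorphic_tori (ppav_of Z)
    (product_of_elliptic_curves \<mu>s :: (complex^'n::{finite,linorder}, 'n \<Rightarrow> complex set) complex_torus)"
proof -
  have linear: "bounded_linear ((*v) A)" "complex_linear ((*v) A)"
    for A :: "complex^'n::{finite,linorder}^'n::{finite,linorder}"
  proof -
    have "linear ((*v) A)"
      by (rule linearI)
         (simp_all add: vec_eq_iff matrix_vector_mult_def
            scaleR_sum_right distrib_left sum.distrib)
    then show "bounded_linear ((*v) A)" by (rule linear_conv_bounded_linear[THEN iffD1])
    show "complex_linear ((*v) A)"
      unfolding complex_linear_def
      by (simp add: matrix_vector_right_distrib vector_scalar_commute)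
  qed
  show ?thesis
  proof (rule isomorphic_tori_quotientI[where L = "riemann_lattice Z" and \<Phi> = "(*v) W" and \<Psi> = "(*v) V"])
    show "carrier (ppav_of Z) = carrier (additive_group Mod riemann_lattice Z)"
      "monoid.mult (ppav_of Z) = monoid.mult (additive_group Mod riemann_lattice Z)"
      "uniformization (ppav_of Z) = (\<lambda>z. riemann_lattice Z #>\<^bsub>additive_group\<^esub> z)"
      by (simp_all add: ppav_of_def complex_torus.defs)
    show "group (product_of_elliptic_curves \<mu>s)"
      unfolding product_of_elliptic_curves_def by (intro group_product_torus group_elliptic_curve)
    show "range (uniformization (product_of_elliptic_curves \<mu>s)) =
        carrier (product_of_elliptic_curves \<mu>s)"
      unfolding product_of_elliptic_curves_def
      by (intro range_uniformization_product_torus range_uniformization_elliptic_curve)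
    show "uniformization (product_of_elliptic_curves \<mu>s) (v + w) =
        uniformization (product_of_elliptic_curves \<mu>s) v \<otimes>\<^bsub>product_of_elliptic_curves \<mu>s\<^esub>
        uniformization (product_of_elliptic_curves \<mu>s) w" for v w :: "complex^'n::{finite,linorder}"
      unfolding product_of_elliptic_curves_def
      by (simp add: fun_eq_iff uniformization_elliptic_curve_add)
    show "z \<in> riemann_lattice Z \<longleftrightarrow>
        uniformization (product_of_elliptic_curves \<mu>s) (W *v z) = \<one>\<^bsub>product_of_elliptic_curves \<mu>s\<^esub>" for z
      unfolding assms(3) product_of_elliptic_curves_def
      by (simp add: fun_eq_iff uniformization_elliptic_curve_eq_one)
    show "V *v (W *v z) = z" "W *v (V *v z) = z" for z
      by (simp_all add: matrix_vector_mul_assoc assms)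
  qed (fact linear)+
qed

section \<open>Unimodular diagonalization of the Riemann matrix\<close>

lemma bij_betw_pos: "bij_betw (pos :: 'n::{finite,linorder} \<Rightarrow> nat) UNIV {1..CARD('n)}"
proof -
  have less: "pos i < pos j" if "i < j" for i j :: 'n
  proof -
    have "{k. k \<le> i} \<subset> {k. k \<le> j}" using that by (auto simp: less_le_not_le)
    then show ?thesis unfolding pos_def by (intro psubset_card_mono) auto
  qed
  then have inj: "inj (pos :: 'n \<Rightarrow> nat)"
    by (metis injI less_irrefl linorder_neqE)
  moreover have "range (pos :: 'n \<Rightarrow> nat) \<subseteq> {1..CARD('n)}"
  proof -
    have "1 \<le> pos i" "pos i \<le> CARD('n)" for i :: 'n
      unfolding pos_def using card_mono[of "{j. j \<le> i}" "{i}"] by (auto intro: card_mono)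
    then show ?thesis by auto
  qed
  ultimately have "range (pos :: 'n \<Rightarrow> nat) = {1..CARD('n)}"
    by (intro card_subset_eq) (auto simp: card_image)
  with inj show ?thesis by (simp add: bij_betw_def)
qed

lemma pos_in: "pos (i :: 'n::{finite,linorder}) \<in> {1..CARD('n)}"
  using bij_betw_pos by (rule bij_betw_apply) simp

lemma pos_inject: "pos i = pos j \<longleftrightarrow> i = (j :: 'n::{finite,linorder})"
  using bij_betw_pos by (metis UNIV_I bij_betw_iff_bijections)

lemma sum_pos: "(\<Sum>i\<in>(UNIV :: 'n::{finite,linorder} set). f (pos i)) = (\<Sum>k=1..CARD('n). f k)"
  by (rule sum.reindex_bij_betw[OF bij_betw_pos])

text \<open>
  A surjective endomorphism of \<open>\<int>\<^sup>n\<close> is an automorphism, so solvability of all integral systems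
  characterizes the integer matrices with an integral inverse, and it can be proved by elimination.
\<close>

definition unimodular :: "nat \<Rightarrow> (nat \<Rightarrow> nat \<Rightarrow> int) \<Rightarrow> bool" where
  "unimodular n P \<longleftrightarrow> (\<forall>b. \<exists>a. \<forall>i\<in>{1..n}. (\<Sum>k=1..n. P i k * a k) = b i)"

definition diagonalizes ::
    "(nat \<Rightarrow> nat \<Rightarrow> int) \<Rightarrow> (nat \<Rightarrow> real) \<Rightarrow> (nat \<Rightarrow> nat \<Rightarrow> int) \<Rightarrow> real^'n::{finite,linorder}^'n::{finite,linorder} \<Rightarrow> bool" where
  "diagonalizes P d Q A \<longleftrightarrow> unimodular CARD('n) P \<and> unimodular CARD('n) Q \<and>
     A = matrix_of (\<lambda>i j. \<Sum>k=1..CARD('n). of_int (P i k) * d k * of_int (Q k j))"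

definition int_mult :: "(nat \<Rightarrow> nat \<Rightarrow> int) \<Rightarrow> int^'n::{finite,linorder} \<Rightarrow> int^'n::{finite,linorder}" where
  "int_mult P x = (\<chi> i. \<Sum>k\<in>UNIV. P (pos i) (pos k) * x $ k)"

definition of_int_vec :: "int^'n \<Rightarrow> ('a::ring_1)^'n" where
  "of_int_vec x = (\<chi> i. of_int (x $ i))"

lemma surj_int_mult:
  assumes "unimodular CARD('n::{finite,linorder}) P"
  shows "surj (int_mult P :: int^'n::{finite,linorder} \<Rightarrow> _)"
  unfolding surj_def
proof
  fix b :: "int^'n::{finite,linorder}"
  define b' where "b' k = b $ inv_into UNIV pos k" for k
  obtain a where a: "\<And>i. i \<in> {1..CARD('n)} \<Longrightarrow> (\<Sum>k=1..CARD('n). P i k * a k) = b' i"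
    using assms unfolding unimodular_def by blast
  have "b' (pos i) = b $ i" for i :: 'n
    using bij_betw_imp_inj_on[OF bij_betw_pos[where 'n = 'n]] by (simp add: b'_def inv_f_f)
  then have "b = int_mult P (\<chi> i. a (pos i))"
    using a[OF pos_in] sum_pos[where 'n = 'n and f = "\<lambda>k. P i k * a k" for i] by (simp add: int_mult_def vec_eq_iff)
  then show "\<exists>x. b = int_mult P x" ..
qed

lemma of_int_vec_mult:
  "of_int_vec (int_mult P x) = matrix_of (\<lambda>i j. of_int (P i j)) *v of_int_vec x"
  by (simp add: of_int_vec_def int_mult_def matrix_of_def matrix_vector_mult_def vec_eq_iff)

lemma unimodular_invertible:
  fixes P :: "nat \<Rightarrow> nat \<Rightarrow> int"
  defines "V \<equiv> (matrix_of (\<lambda>i j. of_int (P i j)) :: ('a::field)^'n::{finite,linorder}^'n::{finite,linorder})"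
  assumes "unimodular CARD('n::{finite,linorder}) P"
  obtains W where "V ** W = mat 1" "W ** V = mat 1"
proof -
  have "\<exists>x. int_mult P x = axis j 1" for j :: 'n
    using surj_int_mult[OF assms(2)] by (metis surjD)
  then obtain x where x: "\<And>j :: 'n. int_mult P (x j) = axis j 1" by metis
  have "V ** (\<chi> i j. of_int_vec (x j) $ i) = mat 1"
  proof -
    have "(V *v of_int_vec (x j)) $ i = (if i = j then 1 else 0)" for i j
      using x[of j] unfolding V_def of_int_vec_mult[symmetric]
      by (simp add: of_int_vec_def axis_def)
    then show ?thesis
      by (simp add: vec_eq_iff matrix_matrix_mult_def matrix_vector_mult_def mat_def)
  qed
  then show ?thesis using that matrix_left_right_inverse by blast
qed

text \<open>
  If \<open>Z = \<tau> P D Q\<close>, then \<open>P\<^sup>-\<^sup>1\<close> maps \<open>\<int>\<^sup>n + Z \<int>\<^sup>n\<close> onto \<open>\<int>\<^sup>n + \<tau> D \<int>\<^sup>n\<close>, because \<open>P\<close> and \<open>Q\<close> map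
  \<open>\<int>\<^sup>n\<close> bijectively to itself; and the latter is the lattice of the product of the curves with moduli \<open>\<tau> d\<^sub>k\<close>.
\<close>

lemma isomorphic_tori_of_diagonalizes:
  fixes A :: "real^'n::{finite,linorder}^'n::{finite,linorder}"
  assumes diag: "diagonalizes P d Q A"
    and Z: "Z = (\<chi> i j. \<tau> * of_real (A $ i $ j))"
    and \<mu>s: "\<And>k. k \<in> {1..CARD('n)} \<Longrightarrow> \<mu>s ! (k - 1) = \<tau> * of_real (d k)"
  shows "isomorphic_tori (ppav_of Z)
    (product_of_elliptic_curves \<mu>s :: (complex^'n::{finite,linorder}, 'n \<Rightarrow> complex set) complex_torus)"
proof -
  have P: "unimodular CARD('n) P" and Q: "unimodular CARD('n) Q"
    using diag unfolding diagonalizes_def by auto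
  define V :: "complex^'n::{finite,linorder}^'n::{finite,linorder}"
    where "V = matrix_of (\<lambda>i j. of_int (P i j))"
  obtain W where W: "V ** W = mat 1" "W ** V = mat 1"
    unfolding V_def by (rule unimodular_invertible[OF P])
  define D where "D x = (\<chi> i. of_int (x $ i) * (\<mu>s ! (pos i - 1)))" for x :: "int^'n::{finite,linorder}"
  have Z_mult: "Z *v of_int_vec x = V *v D (int_mult Q x)" for x
  proof -
    have "(Z *v of_int_vec x) $ i = (V *v D (int_mult Q x)) $ i" for i
    proof -
      have "(Z *v of_int_vec x) $ i = (\<Sum>j\<in>UNIV. \<tau> * of_real (\<Sum>k=1..CARD('n).
          of_int (P (pos i) k) * d k * of_int (Q k (pos j))) * of_int (x $ j))"
        using diag unfolding diagonalizes_def
        by (simp add: Z matrix_vector_mult_def of_int_vec_def matrix_of_def)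
      also have "\<dots> = (\<Sum>j\<in>UNIV. \<tau> * of_real (\<Sum>k\<in>(UNIV :: 'n set).
          of_int (P (pos i) (pos k)) * d (pos k) * of_int (Q (pos k) (pos j))) * of_int (x $ j))"
        by (simp only: sum_pos[of "\<lambda>k. of_int (P _ k) * d k * of_int (Q k _)"])
      also have "\<dots> = (\<Sum>j\<in>UNIV. \<Sum>k\<in>(UNIV :: 'n set). of_int (P (pos i) (pos k)) * (\<tau> * of_real (d (pos k))) *
          (of_int (Q (pos k) (pos j)) * of_int (x $ j)))"
        by (simp add: sum_distrib_left sum_distrib_right mult_ac)
      also have "\<dots> = (\<Sum>k\<in>(UNIV :: 'n set). \<Sum>j\<in>UNIV. of_int (P (pos i) (pos k)) * (\<tau> * of_real (d (pos k))) *
          (of_int (Q (pos k) (pos j)) * of_int (x $ j)))"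
        by (rule sum.swap)
      also have "\<dots> = (V *v D (int_mult Q x)) $ i"
        by (simp add: V_def D_def int_mult_def matrix_of_def matrix_vector_mult_def \<mu>s[OF pos_in, simplified]
          sum_distrib_left mult_ac)
      finally show ?thesis .
    qed
    then show ?thesis by (simp add: vec_eq_iff)
  qed
  have riemann: "riemann_lattice Z = {of_int_vec a + Z *v of_int_vec b | a b. True}"
    unfolding riemann_lattice_def of_int_vec_def by auto
  have split: "(\<forall>i. w $ i \<in> elliptic_lattice (\<mu>s ! (pos i - 1))) \<longleftrightarrow> (\<exists>a b. w = of_int_vec a + D b)"
    for w
  proof
    assume "\<forall>i. w $ i \<in> elliptic_lattice (\<mu>s ! (pos i - 1))"
    then have "\<forall>i. \<exists>a b. w $ i = of_int a + of_int b * (\<mu>s ! (pos i - 1))"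
      unfolding elliptic_lattice_def by blast
    then obtain a b where "\<And>i. w $ i = of_int (a i) + of_int (b i) * (\<mu>s ! (pos i - 1))" by metis
    then have "w = of_int_vec (\<chi> i. a i) + D (\<chi> i. b i)"
      by (simp add: vec_eq_iff of_int_vec_def D_def)
    then show "\<exists>a b. w = of_int_vec a + D b" by blast
  next
    assume "\<exists>a b. w = of_int_vec a + D b"
    then obtain a b where "w = of_int_vec a + D b" by blast
    then have "w $ i = of_int (a $ i) + of_int (b $ i) * (\<mu>s ! (pos i - 1))" for i
      by (simp add: of_int_vec_def D_def)
    then show "\<forall>i. w $ i \<in> elliptic_lattice (\<mu>s ! (pos i - 1))"
      unfolding elliptic_lattice_def by blast
  qed
  have "z \<in> riemann_lattice Z \<longleftrightarrow> (\<exists>a b. W *v z = of_int_vec a + D b)" for z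
  proof
    assume "z \<in> riemann_lattice Z"
    then obtain a b where z: "z = of_int_vec a + Z *v of_int_vec b" unfolding riemann by blast
    obtain a' where a': "a = int_mult P a'" using surj_int_mult[OF P] by (metis surjD)
    have "z = V *v (of_int_vec a' + D (int_mult Q b))"
      unfolding z Z_mult a' of_int_vec_mult V_def by (simp add: matrix_vector_right_distrib)
    then have "W *v z = of_int_vec a' + D (int_mult Q b)"
      by (simp add: matrix_vector_mul_assoc W(2))
    then show "\<exists>a b. W *v z = of_int_vec a + D b" by blast
  next
    assume "\<exists>a b. W *v z = of_int_vec a + D b"
    then obtain a b where "W *v z = of_int_vec a + D b" by blast
    moreover obtain b' where "b = int_mult Q b'" using surj_int_mult[OF Q] by (metis surjD)
    ultimately have "V *v (W *v z) = V *v (of_int_vec a + D (int_mult Q b'))" by simp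
    then have "z = of_int_vec (int_mult P a) + Z *v of_int_vec b'"
      unfolding Z_mult of_int_vec_mult V_def[symmetric]
      by (simp add: matrix_vector_mul_assoc W(1) matrix_vector_right_distrib)
    then show "z \<in> riemann_lattice Z" unfolding riemann by blast
  qed
  then show ?thesis
    using isomorphic_tori_product_of_elliptic_curvesI[OF W] split by blast
qed

section \<open>Recognizing unimodular matrices\<close>

text \<open>
  Back substitution: if the pivots \<open>P (r t) (c t)\<close> are units and the \<open>t\<close>-th pivot column
  vanishes in the rows of the earlier pivots, the unknowns \<open>a (c 1), a (c 2), \<dots>\<close> can be
  chosen successively.
\<close>

lemma unimodular_pivots:
  fixes P :: "nat \<Rightarrow> nat \<Rightarrow> int"
  assumes r: "\<And>i. i \<in> {1..n} \<Longrightarrow> \<exists>t\<in>{1..n}. i = r t"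
    and c: "\<And>t. t \<in> {1..n} \<Longrightarrow> c t \<in> {1..n}"
    and unit: "\<And>t. t \<in> {1..n} \<Longrightarrow> \<bar>P (r t) (c t)\<bar> = 1"
    and zero: "\<And>s t. s \<in> {1..n} \<Longrightarrow> t \<in> {1..n} \<Longrightarrow> s < t \<Longrightarrow> P (r s) (c t) = 0"
  shows "unimodular n P"
  unfolding unimodular_def
proof
  fix b :: "nat \<Rightarrow> int"
  have "\<exists>a. \<forall>t\<in>{1..m}. (\<Sum>k=1..n. P (r t) k * a k) = b (r t)" if "m \<le> n" for m
    using that
  proof (induction m)
    case (Suc m)
    then obtain a where "\<forall>t\<in>{1..m}. (\<Sum>k=1..n. P (r t) k * a k) = b (r t)"
      by (meson Suc_leD)
    then have a: "(\<Sum>k=1..n. P (r t) k * a k) = b (r t)" if "t \<in> {1..m}" for t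
      using that by blast
    let ?t = "Suc m"
    define e where "e = P (r ?t) (c ?t) * (b (r ?t) - (\<Sum>k=1..n. P (r ?t) k * a k))"
    define a' where "a' k = a k + (if k = c ?t then e else 0)" for k
    have sum: "(\<Sum>k=1..n. P i k * a' k) = (\<Sum>k=1..n. P i k * a k) + P i (c ?t) * e" for i
      using c[of ?t] Suc.prems
      by (simp add: a'_def distrib_left sum.distrib if_distrib[of "\<lambda>x. _ * x"] cong: if_cong)
    have "P (r ?t) (c ?t) * P (r ?t) (c ?t) = 1"
      using unit[of ?t] Suc.prems by (auto simp: abs_if split: if_splits)
    then have "(\<Sum>k=1..n. P (r ?t) k * a' k) = b (r ?t)"
      unfolding sum e_def by (simp add: mult.assoc[symmetric])
    moreover have "(\<Sum>k=1..n. P (r s) k * a' k) = b (r s)" if "s \<in> {1..m}" for s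
      unfolding sum using a[OF that] zero[of s ?t] that Suc.prems by simp
    ultimately show ?case
      by (intro exI[of _ a']) (auto simp: le_Suc_eq)
  qed simp
  then obtain a where "\<forall>t\<in>{1..n}. (\<Sum>k=1..n. P (r t) k * a k) = b (r t)" by blast
  then show "\<exists>a. \<forall>i\<in>{1..n}. (\<Sum>k=1..n. P i k * a k) = b i"
    using r by (intro exI[of _ a]) metis
qed

corollary unimodular_lower_triangular:
  assumes "\<And>i. i \<in> {1..n} \<Longrightarrow> \<bar>P i i\<bar> = 1" "\<And>i j. i \<in> {1..n} \<Longrightarrow> j \<in> {1..n} \<Longrightarrow> i < j \<Longrightarrow> P i j = 0"
  shows "unimodular n P"
  by (rule unimodular_pivots[where r = id and c = id]) (use assms in auto)

corollary unimodular_upper_triangular: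
  assumes "\<And>i. i \<in> {1..n} \<Longrightarrow> \<bar>P i i\<bar> = 1" "\<And>i j. i \<in> {1..n} \<Longrightarrow> j \<in> {1..n} \<Longrightarrow> j < i \<Longrightarrow> P i j = 0"
  shows "unimodular n P"
proof (rule unimodular_pivots[where r = "\<lambda>t. n + 1 - t" and c = "\<lambda>t. n + 1 - t"])
  show "\<exists>t\<in>{1..n}. i = n + 1 - t" if "i \<in> {1..n}" for i
    using that by (intro bexI[of _ "n + 1 - i"]) auto
  show "\<bar>P (n + 1 - t) (n + 1 - t)\<bar> = 1" if "t \<in> {1..n}" for t
  proof -
    have "n + 1 - t \<in> {1..n}" using that by auto
    then show ?thesis using assms(1) by simp
  qed
  show "P (n + 1 - s) (n + 1 - t) = 0" if "s \<in> {1..n}" "t \<in> {1..n}" "s < t" for s t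
    using assms(2)[of "n + 1 - s" "n + 1 - t"] that by auto
qed auto

lemma unimodular_right_inverse:
  assumes "\<And>i j. i \<in> {1..n} \<Longrightarrow> j \<in> {1..n} \<Longrightarrow> (\<Sum>k=1..n. P i k * P' k j) = of_bool (i = j)"
  shows "unimodular n P"
  unfolding unimodular_def
proof
  fix b :: "nat \<Rightarrow> int"
  have "(\<Sum>k=1..n. P i k * (\<Sum>j=1..n. P' k j * b j)) = b i" if "i \<in> {1..n}" for i
  proof -
    have "(\<Sum>k=1..n. P i k * (\<Sum>j=1..n. P' k j * b j)) = (\<Sum>j=1..n. (\<Sum>k=1..n. P i k * P' k j) * b j)"
      unfolding sum_distrib_left sum_distrib_right mult.assoc by (rule sum.swap)
    also have "\<dots> = b i" using assms that by simp
    finally show ?thesis .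
  qed
  then show "\<exists>a. \<forall>i\<in>{1..n}. (\<Sum>k=1..n. P i k * a k) = b i"
    by (intro exI[of _ "\<lambda>k. \<Sum>j=1..n. P' k j * b j"]) simp
qed

lemma unimodular_mult:
  assumes "unimodular n P" "unimodular n Q"
  shows "unimodular n (\<lambda>i j. \<Sum>k=1..n. P i k * Q k j)"
  unfolding unimodular_def
proof
  fix b :: "nat \<Rightarrow> int"
  obtain c where c: "\<And>i. i \<in> {1..n} \<Longrightarrow> (\<Sum>k=1..n. P i k * c k) = b i"
    using assms(1) unfolding unimodular_def by blast
  obtain a where a: "\<And>i. i \<in> {1..n} \<Longrightarrow> (\<Sum>k=1..n. Q i k * a k) = c i"
    using assms(2) unfolding unimodular_def by blast
  have "(\<Sum>j=1..n. (\<Sum>k=1..n. P i k * Q k j) * a j) = (\<Sum>k=1..n. P i k * (\<Sum>j=1..n. Q k j * a j))" for i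
    unfolding sum_distrib_left sum_distrib_right mult.assoc by (rule sum.swap)
  also have "\<dots> i = (\<Sum>k=1..n. P i k * c k)" for i
    using a by (intro sum.cong) auto
  finally show "\<exists>a. \<forall>i\<in>{1..n}. (\<Sum>j=1..n. (\<Sum>k=1..n. P i k * Q k j) * a j) = b i"
    using c by (intro exI[of _ a]) simp
qed

text \<open>
  In a basis adapted to the dual lattice, most of the dual basis can be taken from the given dual
  basis, so that the matrix of pairings agrees with the identity in the first \<open>m\<close> columns.
\<close>

definition bordered :: "nat \<Rightarrow> (nat \<Rightarrow> nat \<Rightarrow> int) \<Rightarrow> nat \<Rightarrow> nat \<Rightarrow> int" where
  "bordered m B i j = (if j \<le> m then of_bool (i = j) else B i j)"

lemma sum_bordered:
  fixes g :: "nat \<Rightarrow> 'a::ring_1"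
  assumes "m \<le> n" "1 \<le> i"
  shows "(\<Sum>k=1..n. of_int (bordered m B i k) * g k) =
    (if i \<le> m then g i else 0) + (\<Sum>k=Suc m..n. of_int (B i k) * g k)"
proof -
  have "{1..n} = {1..m} \<union> {Suc m..n}" using assms by auto
  then have "(\<Sum>k=1..n. of_int (bordered m B i k) * g k) =
      (\<Sum>k=1..m. of_int (bordered m B i k) * g k) + (\<Sum>k=Suc m..n. of_int (bordered m B i k) * g k)"
    by (simp add: sum.union_disjoint)
  also have "(\<Sum>k=1..m. of_int (bordered m B i k) * g k) = (\<Sum>k=1..m. if k = i then g i else 0)"
    by (intro sum.cong) (auto simp: bordered_def)
  also have "\<dots> = (if i \<le> m then g i else 0)" using assms by simp
  also have "(\<Sum>k=Suc m..n. of_int (bordered m B i k) * g k) = (\<Sum>k=Suc m..n. of_int (B i k) * g k)"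
    by (intro sum.cong) (auto simp: bordered_def)
  finally show ?thesis .
qed

text \<open>
  If \<open>f\<^sub>1, \<dots>, f\<^sub>m\<close> is a basis and \<open>\<lambda>\<^sub>i = 2 f\<^sub>i - f\<^sub>i\<^sub>-\<^sub>1 - f\<^sub>i\<^sub>+\<^sub>1\<close> for \<open>i < m\<close>, with \<open>f\<^sub>0 = 0\<close>, then
  \<open>f\<^sub>j = j f\<^sub>1 - (\<Sum>i<j. (j - i) \<lambda>\<^sub>i)\<close>. The upper left block contains the coordinates of the \<open>f\<^sub>j\<close> in the
  basis \<open>\<lambda>\<^sub>1, \<dots>, \<lambda>\<^sub>m\<^sub>-\<^sub>1, - f\<^sub>1\<close>. Its pivots are the entries \<open>-1\<close> above the diagonal, from bottom to top,
  and then the entry \<open>-1\<close> in the lower left corner of the block.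
\<close>

lemma unimodular_difference_block:
  fixes R :: "nat \<Rightarrow> nat \<Rightarrow> int"
  assumes "1 \<le> m" "m \<le> n"
    and "\<And>i. i \<in> {m<..n} \<Longrightarrow> \<bar>R i i\<bar> = 1"
    and "\<And>i j. i \<in> {m<..n} \<Longrightarrow> j \<in> {m<..n} \<Longrightarrow> i < j \<Longrightarrow> R i j = 0"
  shows "unimodular n (\<lambda>i j. if i \<le> m then (if j \<le> m then (if i = m then 0 else int (min i j)) - int j else 0) else R i j)"
    (is "unimodular n ?P")
proof (rule unimodular_pivots)
  let ?r = "\<lambda>t. if t < m then m - t else t" and ?c = "\<lambda>t. if t \<le> m then m + 1 - t else t"
  show "\<exists>t\<in>{1..n}. i = ?r t" if "i \<in> {1..n}" for i
    using that assms(1,2) by (intro bexI[of _ "if i < m then m - i else i"]) auto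
  show "?c t \<in> {1..n}" if "t \<in> {1..n}" for t
    using that assms(2) by auto
  show "\<bar>?P (?r t) (?c t)\<bar> = 1" if "t \<in> {1..n}" for t
  proof -
    consider "t < m" | "t = m" | "m < t" by linarith
    then show ?thesis
    proof cases
      case 1
      then have "m - t < m" "m + 1 - t \<le> m" "min (m - t) (m + 1 - t) = m - t" using that by auto
      then show ?thesis using 1 by (simp add: of_nat_diff)
    qed (use that assms(3) in auto)
  qed
  show "?P (?r s) (?c t) = 0" if "s \<in> {1..n}" "t \<in> {1..n}" "s < t" for s t
  proof (cases "t \<le> m")
    case True
    with that have "m - s < m" "m + 1 - t \<le> m - s" "m + 1 - t \<le> m" by auto
    with that True show ?thesis by (simp add: min_absorb2)
  next
    case False
    with that assms(4)[of s t] show ?thesis by (cases "s < m"; cases "s = m") simp_all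
  qed
qed

section \<open>Positive definiteness\<close>

definition pos_def :: "real^'n^'n \<Rightarrow> bool" where
  "pos_def A \<longleftrightarrow> transpose A = A \<and> (\<forall>x. x \<noteq> 0 \<longrightarrow> 0 < x \<bullet> (A *v x))"

lemma pos_def_imp_siegel:
  assumes "pos_def A" "Im \<tau> > 0"
  shows "(\<chi> i j. \<tau> * of_real (A $ i $ j)) \<in> siegel_upper_half_space"
proof -
  have sym: "A $ i $ j = A $ j $ i" for i j
    using assms(1) unfolding pos_def_def transpose_def vec_eq_iff by (metis vec_lambda_beta)
  have "(\<chi> k l. Im ((\<chi> i j. \<tau> * of_real (A $ i $ j)) $ k $ l)) = Im \<tau> *\<^sub>R A"
    by (simp add: vec_eq_iff)
  then have "x \<bullet> ((\<chi> k l. Im ((\<chi> i j. \<tau> * of_real (A $ i $ j)) $ k $ l)) *v x) = Im \<tau> * (x \<bullet> (A *v x))" for x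
    by (simp only: scaleR_matrix_vector_assoc[symmetric] inner_scaleR_right)
  moreover have "transpose (\<chi> i j. \<tau> * complex_of_real (A $ i $ j)) = (\<chi> i j. \<tau> * of_real (A $ i $ j))"
    by (simp add: transpose_def vec_eq_iff sym)
  ultimately show ?thesis
    using assms unfolding siegel_upper_half_space_def pos_def_def by simp
qed

lemma pos_def_inverse:
  fixes A C :: "real^'n^'n"
  assumes "pos_def C" "C ** A = mat 1"
  shows "pos_def A"
proof -
  have C: "transpose C = C" using assms(1) unfolding pos_def_def by simp
  have "transpose A ** C = mat 1"
    by (metis C assms(2) matrix_transpose_mul transpose_mat)
  then have "transpose A = A"
    by (metis assms(2) matrix_mul_assoc matrix_mul_lid matrix_mul_rid)
  moreover have "0 < x \<bullet> (A *v x)" if "x \<noteq> 0" for x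
  proof -
    have x: "x = C *v (A *v x)" by (simp add: matrix_vector_mul_assoc assms(2))
    with that have "A *v x \<noteq> 0" by auto
    then have "0 < (A *v x) \<bullet> (C *v (A *v x))" using assms(1) unfolding pos_def_def by blast
    then show ?thesis using x by (simp add: inner_commute)
  qed
  ultimately show ?thesis unfolding pos_def_def by blast
qed

lemma pos_def_congruence:
  fixes A B W :: "real^'n^'n"
  assumes "pos_def A" "B ** W = mat 1"
  shows "pos_def (B ** A ** transpose B)"
proof -
  have "transpose (B ** A ** transpose B) = B ** A ** transpose B"
    using assms(1) unfolding pos_def_def by (simp add: matrix_transpose_mul matrix_mul_assoc)
  moreover have "0 < x \<bullet> ((B ** A ** transpose B) *v x)" if "x \<noteq> 0" for x
  proof -
    define y where "y = transpose B *v x"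
    have "transpose W *v y = x"
      unfolding y_def matrix_vector_mul_assoc matrix_transpose_mul[symmetric] assms(2) by simp
    with that have "y \<noteq> 0" by auto
    then have "0 < y \<bullet> (A *v y)" using assms(1) unfolding pos_def_def by blast
    also have "\<dots> = x \<bullet> (B *v (A *v y))"
      unfolding y_def by (metis dot_lmul_matrix vector_transpose_matrix transpose_transpose)
    finally show ?thesis by (simp only: y_def matrix_vector_mul_assoc matrix_mul_assoc)
  qed
  ultimately show ?thesis unfolding pos_def_def by blast
qed

lemma pos_def_matrix_ofI:
  fixes M :: "nat \<Rightarrow> nat \<Rightarrow> real"
  assumes sym: "\<And>i j. i \<in> {1..CARD('n)} \<Longrightarrow> j \<in> {1..CARD('n)} \<Longrightarrow> M i j = M j i"
    and pos: "\<And>x. \<exists>i\<in>{1..CARD('n)}. x i \<noteq> 0 \<Longrightarrow>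
      0 < (\<Sum>i=1..CARD('n). \<Sum>j=1..CARD('n). x i * M i j * x j)"
  shows "pos_def (matrix_of M :: real^'n::{finite,linorder}^'n::{finite,linorder})"
proof -
  have "0 < x \<bullet> (matrix_of M *v x)" if "x \<noteq> 0" for x :: "real^'n::{finite,linorder}"
  proof -
    define y where "y k = x $ inv_into UNIV pos k" for k
    have y: "x $ i = y (pos i)" for i
      using bij_betw_imp_inj_on[OF bij_betw_pos[where 'n = 'n]] by (simp add: y_def)
    obtain i where "x $ i \<noteq> 0" using \<open>x \<noteq> 0\<close> by (metis vec_eq_iff zero_index)
    then have "0 < (\<Sum>i=1..CARD('n). \<Sum>j=1..CARD('n). y i * M i j * y j)"
      by (intro pos bexI[of _ "pos i"] pos_in) (simp add: y)
    also have "\<dots> = (\<Sum>i\<in>(UNIV :: 'n set). \<Sum>j\<in>(UNIV :: 'n set). y (pos i) * M (pos i) (pos j) * y (pos j))"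
      by (simp only: sum_pos[where 'n = 'n, symmetric])
    also have "\<dots> = x \<bullet> (matrix_of M *v x)"
      by (simp add: inner_vec_def matrix_vector_mult_def matrix_of_def y sum_distrib_left mult_ac)
    finally show ?thesis .
  qed
  then show ?thesis
    unfolding pos_def_def using sym[OF pos_in pos_in]
    by (auto simp: transpose_def matrix_of_def vec_eq_iff)
qed

text \<open>
  By Abel summation, the quadratic form is a positive combination of squares of the linear forms
  \<open>\<Sum>i\<ge>k. \<beta> i * x i\<close>, with coefficients \<open>g k - g (k - 1)\<close>. These forms are triangular, so they do not
  vanish simultaneously. All the classical series except \<open>D\<^sub>n\<close> have this shape.
\<close>

lemma pos_def_min_kernel:
  fixes \<beta> g :: "nat \<Rightarrow> real"
  assumes g: "g 0 = 0" "\<And>k. k \<in> {1..CARD('n)} \<Longrightarrow> g (k - 1) < g k"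
    and \<beta>: "\<And>k. k \<in> {1..CARD('n)} \<Longrightarrow> \<beta> k \<noteq> 0"
    and M: "\<And>i j. i \<in> {1..CARD('n)} \<Longrightarrow> j \<in> {1..CARD('n)} \<Longrightarrow> M i j = \<beta> i * \<beta> j * g (min i j)"
  shows "pos_def (matrix_of M :: real^'n::{finite,linorder}^'n::{finite,linorder})"
proof (rule pos_def_matrix_ofI)
  define n where "n = CARD('n)"
  show "M i j = M j i" if "i \<in> {1..CARD('n)}" "j \<in> {1..CARD('n)}" for i j
    using M that by (simp add: min.commute)
  fix x :: "nat \<Rightarrow> real" assume "\<exists>i\<in>{1..CARD('n)}. x i \<noteq> 0"
  then have ne: "{i\<in>{1..n}. x i \<noteq> 0} \<noteq> {}" unfolding n_def by blast
  \<comment> \<open>At the last index with a nonzero coordinate the linear form reduces to a single term.\<close>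
  define p where "p = Max {i\<in>{1..n}. x i \<noteq> 0}"
  have p: "p \<in> {1..n}" "x p \<noteq> 0" using Max_in[OF _ ne] unfolding p_def by auto
  have zero: "x i = 0" if "i \<in> {1..n}" "p < i" for i
    using that Max_ge[of "{i\<in>{1..n}. x i \<noteq> 0}" i] unfolding p_def by fastforce
  define h where "h k = g k - g (k - 1)" for k
  define s where "s k = (\<Sum>i=1..n. of_bool (k \<le> i) * (\<beta> i * x i))" for k
  have telescope: "g m = (\<Sum>k=1..n. of_bool (k \<le> m) * h k)" if "m \<le> n" for m
  proof -
    have "g m = (\<Sum>k=1..m. h k)"
      unfolding h_def using g(1) by (induction m) auto
    also have "\<dots> = (\<Sum>k=1..n. of_bool (k \<le> m) * h k)"
      using that by (intro sum.mono_neutral_cong_left) auto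
    finally show ?thesis .
  qed
  have "(\<Sum>i=1..n. \<Sum>j=1..n. x i * M i j * x j) = (\<Sum>i=1..n. \<Sum>j=1..n. \<Sum>k=1..n.
      h k * ((of_bool (k \<le> i) * (\<beta> i * x i)) * (of_bool (k \<le> j) * (\<beta> j * x j))))"
  proof (intro sum.cong refl)
    fix i j assume ij: "i \<in> {1..n}" "j \<in> {1..n}"
    have "x i * M i j * x j = (\<beta> i * x i) * (\<beta> j * x j) * g (min i j)"
      using ij M[of i j] by (simp add: n_def)
    also have "g (min i j) = (\<Sum>k=1..n. of_bool (k \<le> min i j) * h k)"
      using ij by (intro telescope) auto
    also have "(\<beta> i * x i) * (\<beta> j * x j) * \<dots> =
        (\<Sum>k=1..n. h k * ((of_bool (k \<le> i) * (\<beta> i * x i)) * (of_bool (k \<le> j) * (\<beta> j * x j))))"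
      unfolding sum_distrib_left by (intro sum.cong) auto
    finally show "x i * M i j * x j = \<dots>" .
  qed
  also have "\<dots> = (\<Sum>i=1..n. \<Sum>k=1..n. \<Sum>j=1..n.
      h k * ((of_bool (k \<le> i) * (\<beta> i * x i)) * (of_bool (k \<le> j) * (\<beta> j * x j))))"
    by (intro sum.cong refl sum.swap)
  also have "\<dots> = (\<Sum>k=1..n. \<Sum>i=1..n. \<Sum>j=1..n.
      h k * ((of_bool (k \<le> i) * (\<beta> i * x i)) * (of_bool (k \<le> j) * (\<beta> j * x j))))"
    by (rule sum.swap)
  also have "\<dots> = (\<Sum>k=1..n. h k * (s k * s k))"
    unfolding s_def sum_product unfolding sum_distrib_left ..
  also have "\<dots> > 0"
  proof (rule sum_pos2[of _ p])
    have "s p = (\<Sum>i=1..n. if i = p then \<beta> p * x p else 0)"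
      unfolding s_def using zero by (intro sum.cong) auto
    also have "\<dots> = \<beta> p * x p" using p by simp
    finally have "s p \<noteq> 0" using p \<beta> by (simp add: n_def)
    then show "0 < h p * (s p * s p)"
      using p g(2)[of p] by (simp add: h_def n_def zero_less_mult_iff linorder_neq_iff disj_commute)
    show "0 \<le> h k * (s k * s k)" if "k \<in> {1..n}" for k
      using g(2)[of k] that by (simp add: h_def n_def)
  qed (use p in auto)
  finally show "0 < (\<Sum>i=1..CARD('n). \<Sum>j=1..CARD('n). x i * M i j * x j)"
    unfolding n_def .
qed

section \<open>The classical series\<close>

lemma matrix_of_cong:
  fixes M N :: "nat \<Rightarrow> nat \<Rightarrow> 'a"
  assumes "\<And>i j. i \<in> {1..CARD('n)} \<Longrightarrow> j \<in> {1..CARD('n)} \<Longrightarrow> M i j = N i j"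
  shows "matrix_of M = (matrix_of N :: 'a^'n::{finite,linorder}^'n::{finite,linorder})"
  unfolding matrix_of_def using assms[OF pos_in pos_in] by simp

lemma diagonalizesI:
  assumes "unimodular CARD('n) P" "unimodular CARD('n) Q"
    and "\<And>i j. i \<in> {1..CARD('n)} \<Longrightarrow> j \<in> {1..CARD('n)} \<Longrightarrow>
      (\<Sum>k=1..CARD('n). of_int (P i k) * d k * of_int (Q k j)) = M i j"
  shows "diagonalizes P d Q (matrix_of M :: real^'n::{finite,linorder}^'n::{finite,linorder})"
  unfolding diagonalizes_def
  by (intro conjI assms(1,2) matrix_of_cong) (rule assms(3)[symmetric])

definition pos_def_diagonalized :: "real^'n::{finite,linorder}^'n::{finite,linorder} \<Rightarrow> (nat \<Rightarrow> real) \<Rightarrow> bool" where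
  "pos_def_diagonalized A d \<longleftrightarrow> pos_def A \<and> (\<exists>P Q. diagonalizes P d Q A)"

text \<open>
  The matrix is the inverse of the Cartan matrix \<open>C\<close>. It maps the columns \<open>C e\<^sub>1, \<dots>, C e\<^sub>n\<^sub>-\<^sub>1\<close> to unit
  vectors and \<open>- e\<^sub>1\<close> to \<open>1 / (n + 1)\<close> times the integral vector with entries \<open>- (n + 1 - i)\<close>. The columns
  of \<open>P\<close> are these images without the factor, and \<open>Q\<close> is the inverse of the matrix with columns
  \<open>C e\<^sub>1, \<dots>, C e\<^sub>n\<^sub>-\<^sub>1, - e\<^sub>1\<close>.
\<close>

lemma split_A:
  assumes n: "n = CARD('n)"
  shows "pos_def_diagonalized (Z0 (An n) :: real^'n::{finite,linorder}^'n::{finite,linorder})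
    (\<lambda>k. if k < n then 1 else 1 / real (n + 1))"
proof -
  let ?d = "\<lambda>k. if k < n then 1 else 1 / real (n + 1)"
  let ?M = "symmetrize (\<lambda>i j. real i * (real n + 1 - real j) / (real n + 1))"
  let ?P = "bordered (n - 1) (\<lambda>i j. - int (n + 1 - i))"
  let ?Q = "\<lambda>i j. if i \<le> n then (if j \<le> n then (if i = n then 0 else int (min i j)) - int j else 0) else 0"
  have "1 \<le> n" unfolding n by simp
  have "pos_def (matrix_of ?M :: real^'n::{finite,linorder}^'n::{finite,linorder})"
  proof (rule pos_def_min_kernel[where \<beta> = "\<lambda>i. real (n + 1 - i)" and g = "\<lambda>k. real k / (real (n + 1) * real (n + 1 - k))"])
    show "real (k - 1) / (real (n + 1) * real (n + 1 - (k - 1))) < real k / (real (n + 1) * real (n + 1 - k))"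
      if "k \<in> {1..CARD('n)}" for k
    proof (rule frac_less)
      show "real (n + 1) * real (n + 1 - k) \<le> real (n + 1) * real (n + 1 - (k - 1))"
        by (intro mult_left_mono) auto
    qed (use that n in auto)
    show "?M i j = real (n + 1 - i) * real (n + 1 - j) * (real (min i j) / (real (n + 1) * real (n + 1 - min i j)))"
      if "i \<in> {1..CARD('n)}" "j \<in> {1..CARD('n)}" for i j
    proof -
      have cancel: "a * b * (x / (c * a)) = x * b / c" if "a \<noteq> 0" for a b c x :: real
        using that by simp
      have "real (n + 1 - i) \<noteq> 0" "real (n + 1 - j) \<noteq> 0"
        "real (n + 1 - i) = real n + 1 - real i" "real (n + 1 - j) = real n + 1 - real j"
        using that n by (auto simp: of_nat_diff)
      then show ?thesis
        using cancel[of "real (n + 1 - i)" "real (n + 1 - j)" "real i" "real (n + 1)"]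
          cancel[of "real (n + 1 - j)" "real (n + 1 - i)" "real j" "real (n + 1)"]
        by (cases "i \<le> j") (simp_all add: symmetrize_def min_def max_def mult.commute add.commute)
    qed
  qed (use n in auto)
  moreover have "diagonalizes ?P ?d ?Q (matrix_of ?M :: real^'n::{finite,linorder}^'n::{finite,linorder})"
  proof (rule diagonalizesI)
    show "unimodular CARD('n) ?P"
      unfolding n[symmetric] by (rule unimodular_upper_triangular) (auto simp: bordered_def)
    show "unimodular CARD('n) ?Q"
      unfolding n[symmetric] by (rule unimodular_difference_block) (use \<open>1 \<le> n\<close> in auto)
    show "(\<Sum>k=1..CARD('n). of_int (?P i k) * ?d k * of_int (?Q k j)) = ?M i j"
      if "i \<in> {1..CARD('n)}" "j \<in> {1..CARD('n)}" for i j
    proof -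
      have ij: "i \<in> {1..n}" "j \<in> {1..n}" using that unfolding n .
      have "{Suc (n - 1)..n} = {n}" using \<open>1 \<le> n\<close> by auto
      then have tail: "sum f {Suc (n - 1)..n} = f n" for f :: "nat \<Rightarrow> real" by simp
      have "(\<Sum>k=1..n. of_int (?P i k) * (?d k * of_int (?Q k j))) =
          (if i \<le> n - 1 then ?d i * of_int (?Q i j) else 0) +
          (\<Sum>k=Suc (n - 1)..n. of_int (- int (n + 1 - i)) * (?d k * of_int (?Q k j)))"
        by (rule sum_bordered) (use ij in auto)
      also have "\<dots> = (if i \<le> n - 1 then ?d i * of_int (?Q i j) else 0) +
          of_int (- int (n + 1 - i)) * (?d n * of_int (?Q n j))"
        unfolding tail ..
      also have "\<dots> = ?M i j"
      proof (cases "i = n")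
        case True
        then show ?thesis using ij by (auto simp: symmetrize_def)
      next
        case False
        then show ?thesis using ij
          by (cases "i \<le> j") (auto simp: symmetrize_def min_def max_def of_nat_diff field_simps)
      qed
      finally show ?thesis unfolding n[symmetric] mult.assoc .
    qed
  qed
  ultimately show ?thesis unfolding pos_def_diagonalized_def by auto
qed

lemma split_B:
  "pos_def_diagonalized (Z0 (Bn n) :: real^'n::{finite,linorder}^'n::{finite,linorder}) (\<lambda>k. 1)"
proof -
  let ?L = "\<lambda>i k :: nat. of_bool (k \<le> i) :: int"
  have "pos_def (Z0 (Bn n) :: real^'n::{finite,linorder}^'n::{finite,linorder})"
    unfolding Z0.simps
    by (rule pos_def_min_kernel[where \<beta> = "\<lambda>i. 1" and g = real]) auto
  moreover have "diagonalizes ?L (\<lambda>k. 1) (\<lambda>k j. ?L j k) (Z0 (Bn n) :: real^'n::{finite,linorder}^'n::{finite,linorder})"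
    unfolding Z0.simps
  proof (rule diagonalizesI)
    show "unimodular CARD('n) ?L" by (rule unimodular_lower_triangular) auto
    show "unimodular CARD('n) (\<lambda>k j. ?L j k)" by (rule unimodular_upper_triangular) auto
    show "(\<Sum>k=1..CARD('n). of_int (?L i k) * 1 * of_int (?L j k)) = real (min i j)"
      if "i \<in> {1..CARD('n)}" "j \<in> {1..CARD('n)}" for i j
    proof -
      have "(\<Sum>k=1..CARD('n). of_int (?L i k) * 1 * of_int (?L j k)) = (\<Sum>k\<in>{1..min i j}. 1 :: real)"
        using that by (intro sum.mono_neutral_cong_right) auto
      then show ?thesis by simp
    qed
  qed
  ultimately show ?thesis unfolding pos_def_diagonalized_def by auto
qed

text \<open>
  The Gram matrix of \<open>f\<^sub>i = e\<^sub>1 + \<dots> + e\<^sub>i\<close> for \<open>i < n\<close> and \<open>s = (e\<^sub>1 + \<dots> + e\<^sub>n) / 2\<close>, which together form a basis of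
  \<open>\<int>\<^sup>n + \<int> s\<close>.
\<close>

definition last_halved :: "nat \<Rightarrow> nat \<Rightarrow> nat \<Rightarrow> real" where
  "last_halved n i j = (if i = n then 1/2 else 1) * (if j = n then 1/2 else 1) * real (min i j)"

lemma Z0_C:
  assumes n: "n = CARD('n)"
  shows "Z0 (Cn n) = (matrix_of (last_halved n) :: real^'n::{finite,linorder}^'n::{finite,linorder})"
  unfolding Z0.simps
proof (rule matrix_of_cong)
  show "symmetrize (\<lambda>i j. if j \<le> n - 1 then real i else if i \<le> n - 1 then real i / 2 else real n / 4) i j =
      last_halved n i j" if "i \<in> {1..CARD('n)}" "j \<in> {1..CARD('n)}" for i j
    using that n by (auto simp: symmetrize_def last_halved_def min_def max_def)
qed

text \<open>
  The lattice \<open>\<int>\<^sup>n + \<int> s\<close> has the basis \<open>e\<^sub>i - e\<^sub>i\<^sub>+\<^sub>1\<close> (\<open>i \<le> n - 2\<close>), \<open>e\<^sub>2 + \<dots> + e\<^sub>n\<close>, \<open>s\<close>. As \<open>n - 1\<close> is even, these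
  vectors, with \<open>4 s\<close> in place of \<open>s\<close>, are integral with even coordinate sum, and they form a basis of
  the dual lattice. \<open>P\<close> pairs the \<open>f\<^sub>i\<close> and \<open>s\<close> with the latter basis; \<open>Q\<close> expresses them in the former.
\<close>

lemma split_last_halved_odd:
  assumes n: "n = CARD('n)" and "n \<ge> 3" "odd n"
  shows "pos_def_diagonalized (matrix_of (last_halved n) :: real^'n::{finite,linorder}^'n::{finite,linorder})
    (\<lambda>k. if k < n then 1 else 1 / 4)"
proof -
  let ?d = "\<lambda>k. if k < n then 1 else 1 / 4 :: real"
  obtain p where p: "n = 2 * p + 1" using \<open>odd n\<close> by (elim oddE)
  let ?B = "\<lambda>i k. if k = n - 1 then (if i < n then int i - 1 else int p) else if i < n then 2 * int i else int n"
  let ?P = "bordered (n - 2) ?B"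
  let ?R = "\<lambda>i j. if j < n then 2 * int j else 1"
  let ?Q = "\<lambda>i j. if i \<le> n - 1 then (if j \<le> n - 1 then (if i = n - 1 then 0 else int (min i j)) - int j else 0) else ?R i j"
  have tail: "sum f {Suc (n - 2)..n} = f (n - 1) + f n" for f :: "nat \<Rightarrow> 'a::comm_monoid_add"
  proof -
    have "{Suc (n - 2)..n} = {n - 1, n}" using \<open>n \<ge> 3\<close> by auto
    then show ?thesis using \<open>n \<ge> 3\<close> by simp
  qed
  have "pos_def (matrix_of (last_halved n) :: real^'n::{finite,linorder}^'n::{finite,linorder})"
    by (rule pos_def_min_kernel[where \<beta> = "\<lambda>i. if i = n then 1/2 else 1" and g = real])
       (auto simp: last_halved_def)
  moreover have "diagonalizes ?P ?d ?Q (matrix_of (last_halved n) :: real^'n::{finite,linorder}^'n::{finite,linorder})"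
  proof (rule diagonalizesI)
    show "unimodular CARD('n) ?P"
      unfolding unimodular_def n[symmetric]
    proof
      fix b :: "nat \<Rightarrow> int"
      \<comment> \<open>The lower right 2-by-2 block of \<open>P\<close> has determinant \<open>-1\<close>; \<open>u\<close>, \<open>v\<close> come from its inverse.\<close>
      define u where "u = 2 * (int n - 1) * b n - int n * b (n - 1)"
      define v where "v = int p * b (n - 1) - (int n - 2) * b n"
      define a where "a i = (if i = n then v else if i = n - 1 then u else b i - (int i - 1) * u - 2 * int i * v)" for i
      have a_last: "a (n - 1) = u" "a n = v" using \<open>n \<ge> 3\<close> by (auto simp: a_def)
      have "(\<Sum>k=1..n. ?P i k * a k) = b i" if i: "i \<in> {1..n}" for i
      proof -
        have "(\<Sum>k=1..n. ?P i k * a k) = (if i \<le> n - 2 then a i else 0) + (?B i (n - 1) * u + ?B i n * v)"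
          using sum_bordered[of "n - 2" n i ?B a] i \<open>n \<ge> 3\<close> a_last by (simp add: tail)
        moreover consider "i \<le> n - 2" "i < n - 1" "i < n" | "i = n - 1" "i < n" | "i = n" using i by fastforce
        then have "(if i \<le> n - 2 then a i else 0) + (?B i (n - 1) * u + ?B i n * v) = b i"
          using \<open>n \<ge> 3\<close> by cases (auto simp: a_def u_def v_def p algebra_simps)
        ultimately show ?thesis by simp
      qed
      then show "\<exists>a. \<forall>i\<in>{1..n}. (\<Sum>k=1..n. ?P i k * a k) = b i"
        by (intro exI[of _ a]) simp
    qed
    show "unimodular CARD('n) ?Q"
      unfolding n[symmetric] by (rule unimodular_difference_block) (use \<open>n \<ge> 3\<close> in auto)
    show "(\<Sum>k=1..CARD('n). of_int (?P i k) * ?d k * of_int (?Q k j)) = last_halved n i j"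
      if "i \<in> {1..CARD('n)}" "j \<in> {1..CARD('n)}" for i j
    proof -
      have ij: "i \<in> {1..n}" "j \<in> {1..n}" using that unfolding n .
      have "(\<Sum>k=1..n. of_int (?P i k) * (?d k * of_int (?Q k j))) =
          (if i \<le> n - 2 then ?d i * of_int (?Q i j) else 0) +
          (\<Sum>k=Suc (n - 2)..n. of_int (?B i k) * (?d k * of_int (?Q k j)))"
        by (rule sum_bordered) (use ij in auto)
      also have "\<dots> = (if i \<le> n - 2 then ?d i * of_int (?Q i j) else 0) +
          (of_int (?B i (n - 1)) * (?d (n - 1) * of_int (?Q (n - 1) j)) +
           of_int (?B i n) * (?d n * of_int (?Q n j)))"
        unfolding tail ..
      also have "\<dots> = last_halved n i j"
      proof -
        consider "i \<le> n - 2" "i < n - 1" "i < n" | "i = n - 1" "i < n" | "i = n"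
          using ij by fastforce
        then show ?thesis
          using ij \<open>n \<ge> 3\<close> p
          by cases (auto simp: last_halved_def min_def of_nat_diff field_simps)
      qed
      finally show ?thesis unfolding n[symmetric] mult.assoc .
    qed
  qed
  ultimately show ?thesis unfolding pos_def_diagonalized_def by auto
qed

text \<open>
  Here the basis \<open>e\<^sub>i - e\<^sub>i\<^sub>+\<^sub>1\<close> (\<open>i \<le> n - 3\<close>), \<open>e\<^sub>2 + \<dots> + e\<^sub>n\<^sub>-\<^sub>1\<close>, \<open>e\<^sub>n\<close>, \<open>s\<close> of \<open>\<int>\<^sup>n + \<int> s\<close> is adapted to the dual lattice:
  as \<open>n\<close> is even, \<open>2 s\<close> already has an even coordinate sum, and so do \<open>2 e\<^sub>n\<close> and the other vectors.
\<close>

lemma split_last_halved_even: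
  assumes n: "n = CARD('n)" and "n \<ge> 3" "even n"
  shows "pos_def_diagonalized (matrix_of (last_halved n) :: real^'n::{finite,linorder}^'n::{finite,linorder})
    (\<lambda>k. if k < n - 1 then 1 else 1 / 2)"
proof -
  let ?d = "\<lambda>k. if k < n - 1 then 1 else 1 / 2 :: real"
  obtain p where p: "n = 2 * p" using \<open>even n\<close> by (elim evenE)
  with \<open>n \<ge> 3\<close> have "n \<ge> 4" by presburger
  let ?B = "\<lambda>i k. if k = n - 2 then (if i < n then int i - 1 else int p - 1)
    else if k = n - 1 then (if i < n then 0 else 1) else if i < n then int i else int p"
  let ?P = "bordered (n - 3) ?B"
  let ?R = "\<lambda>i j. if i = n - 1 then (if j < n - 1 then - int j else if j = n - 1 then - 1 else 0)
    else (if j < n - 1 then 2 * int j else if j = n - 1 then 2 else 1)"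
  let ?Q = "\<lambda>i j. if i \<le> n - 2 then (if j \<le> n - 2 then (if i = n - 2 then 0 else int (min i j)) - int j else 0) else ?R i j"
  have tail: "sum f {Suc (n - 3)..n} = f (n - 2) + (f (n - 1) + f n)" for f :: "nat \<Rightarrow> 'a::comm_monoid_add"
  proof -
    have "{Suc (n - 3)..n} = {n - 2, n - 1, n}" using \<open>n \<ge> 4\<close> by auto
    moreover have "n - 2 \<noteq> n - 1" "n - 2 \<noteq> n" "n - 1 \<noteq> n" using \<open>n \<ge> 4\<close> by auto
    ultimately show ?thesis by simp
  qed
  have cases: "(i \<le> n - 3 \<and> i < n - 2 \<and> i < n) \<or> (i = n - 2 \<and> i < n) \<or> (i = n - 1 \<and> i < n) \<or> i = n"
    if "i \<in> {1..n}" for i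
    using that by auto
  have "pos_def (matrix_of (last_halved n) :: real^'n::{finite,linorder}^'n::{finite,linorder})"
    by (rule pos_def_min_kernel[where \<beta> = "\<lambda>i. if i = n then 1/2 else 1" and g = real])
       (auto simp: last_halved_def)
  moreover have "diagonalizes ?P ?d ?Q (matrix_of (last_halved n) :: real^'n::{finite,linorder}^'n::{finite,linorder})"
  proof (rule diagonalizesI)
    show "unimodular CARD('n) ?P"
      unfolding unimodular_def n[symmetric]
    proof
      fix b :: "nat \<Rightarrow> int"
      \<comment> \<open>Rows \<open>n - 2\<close> and \<open>n - 1\<close> involve only \<open>u\<close> and \<open>w\<close> from the last three unknowns, through a
        block of determinant \<open>-1\<close>; row \<open>n\<close> then determines \<open>v\<close>, whose coefficient is 1.\<close>
      define u where "u = (int n - 2) * b (n - 1) - (int n - 1) * b (n - 2)"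
      define w where "w = (int n - 2) * b (n - 2) - (int n - 3) * b (n - 1)"
      define v where "v = b n - (int p - 1) * u - int p * w"
      define a where "a i = (if i = n then w else if i = n - 1 then v else if i = n - 2 then u
        else b i - (int i - 1) * u - int i * w)" for i
      have a_last: "a (n - 2) = u" "a (n - 1) = v" "a n = w" using \<open>n \<ge> 4\<close> by (auto simp: a_def)
      have "(\<Sum>k=1..n. ?P i k * a k) = b i" if i: "i \<in> {1..n}" for i
      proof -
        have "(\<Sum>k=1..n. ?P i k * a k) =
            (if i \<le> n - 3 then a i else 0) + (?B i (n - 2) * u + (?B i (n - 1) * v + ?B i n * w))"
          using sum_bordered[of "n - 3" n i ?B a] i \<open>n \<ge> 4\<close> a_last by (simp add: tail)
        moreover have "(if i \<le> n - 3 then a i else 0) +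
            (?B i (n - 2) * u + (?B i (n - 1) * v + ?B i n * w)) = b i"
          using cases[OF i]
        proof (elim disjE conjE)
          assume "i \<le> n - 3" "i < n - 2" "i < n"
          moreover from this have "i \<noteq> n - 1" by auto
          moreover have "n - 1 \<noteq> n - 2" "n \<noteq> n - 2" "n \<noteq> n - 1" using \<open>n \<ge> 4\<close> by auto
          ultimately show ?thesis by (simp add: a_def)
        next
          assume "i = n - 2" "i < n"
          moreover from this have "\<not> i \<le> n - 3" "int i = int n - 2" using \<open>n \<ge> 4\<close> by auto
          moreover have "n - 1 \<noteq> n - 2" "n \<noteq> n - 2" "n \<noteq> n - 1" using \<open>n \<ge> 4\<close> by auto
          ultimately show ?thesis by (simp add: u_def w_def algebra_simps)
        next
          assume "i = n - 1" "i < n"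
          moreover from this have "\<not> i \<le> n - 3" "int i = int n - 1" using \<open>n \<ge> 4\<close> by auto
          moreover have "n - 1 \<noteq> n - 2" "n \<noteq> n - 2" "n \<noteq> n - 1" using \<open>n \<ge> 4\<close> by auto
          ultimately show ?thesis by (simp add: u_def w_def algebra_simps)
        next
          assume "i = n"
          moreover have "n - 1 \<noteq> n - 2" "n \<noteq> n - 2" "n \<noteq> n - 1" "\<not> n \<le> n - 3" using \<open>n \<ge> 4\<close> by auto
          ultimately show ?thesis by (simp add: v_def)
        qed
        ultimately show ?thesis by simp
      qed
      then show "\<exists>a. \<forall>i\<in>{1..n}. (\<Sum>k=1..n. ?P i k * a k) = b i"
        by (intro exI[of _ a]) simp
    qed
    show "unimodular CARD('n) ?Q"
      unfolding n[symmetric] by (rule unimodular_difference_block) (use \<open>n \<ge> 4\<close> in auto)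
    show "(\<Sum>k=1..CARD('n). of_int (?P i k) * ?d k * of_int (?Q k j)) = last_halved n i j"
      if "i \<in> {1..CARD('n)}" "j \<in> {1..CARD('n)}" for i j
    proof -
      have ij: "i \<in> {1..n}" "j \<in> {1..n}" using that unfolding n .
      have "(\<Sum>k=1..n. of_int (?P i k) * (?d k * of_int (?Q k j))) =
          (if i \<le> n - 3 then ?d i * of_int (?Q i j) else 0) +
          (\<Sum>k=Suc (n - 3)..n. of_int (?B i k) * (?d k * of_int (?Q k j)))"
        by (rule sum_bordered) (use ij in auto)
      also have "\<dots> = (if i \<le> n - 3 then ?d i * of_int (?Q i j) else 0) +
          (of_int (?B i (n - 2)) * (?d (n - 2) * of_int (?Q (n - 2) j)) +
           (of_int (?B i (n - 1)) * (?d (n - 1) * of_int (?Q (n - 1) j)) +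
            of_int (?B i n) * (?d n * of_int (?Q n j))))"
        unfolding tail ..
      also have "\<dots> = last_halved n i j"
      proof -
        have p': "real n = 2 * real p" using p by simp
        have ne: "n - 1 \<noteq> n - 2" "n \<noteq> n - 2" "n \<noteq> n - 1" "\<not> n \<le> n - 3" "\<not> n \<le> n - 2" "\<not> n - 1 \<le> n - 2"
          "\<not> n - 1 \<le> n - 3" "\<not> n - 2 \<le> n - 3" "n - 1 < n" "n - 2 < n" "n - 2 < n - 1"
          "\<not> n < n - 1" "real (n - 1) = 2 * real p - 1" "real (n - 2) = 2 * real p - 2"
          using \<open>n \<ge> 4\<close> p' by (auto simp: of_nat_diff)
        have j: "(j < n - 2 \<and> \<not> n - 2 \<le> j \<and> j < n - 1 \<and> j < n) \<or> j = n - 2 \<or> j = n - 1 \<or> j = n"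
          using ij by auto
        show ?thesis
          using cases[OF ij(1)] j
        proof (elim disjE conjE)
        qed (use ne p' in \<open>simp_all add: last_halved_def min_def field_simps\<close>)
      qed
      finally show ?thesis unfolding n[symmetric] mult.assoc .
    qed
  qed
  ultimately show ?thesis unfolding pos_def_diagonalized_def by auto
qed

lemma matrix_of_mult:
  "matrix_of M ** matrix_of N =
    (matrix_of (\<lambda>i j. \<Sum>k=1..CARD('n). M i k * N k j) :: ('a::semiring_1)^'n::{finite,linorder}^'n::{finite,linorder})"
proof -
  have "(\<Sum>k=1..CARD('n). M i k * N k j) = (\<Sum>k\<in>(UNIV :: 'n set). M i (pos k) * N (pos k) j)" for i j
    by (rule sum_pos[symmetric])
  then show ?thesis by (simp add: matrix_of_def matrix_matrix_mult_def)
qed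

lemma diagonalizes_iff:
  "diagonalizes P d Q A \<longleftrightarrow> unimodular CARD('n) P \<and> unimodular CARD('n) Q \<and>
    A = matrix_of (\<lambda>i j. of_int (P i j) * d j) **
      (matrix_of (\<lambda>i j. of_int (Q i j)) :: real^'n::{finite,linorder}^'n::{finite,linorder})"
  unfolding diagonalizes_def matrix_of_mult ..

definition real_matrix :: "(nat \<Rightarrow> nat \<Rightarrow> int) \<Rightarrow> real^'n::{finite,linorder}^'n::{finite,linorder}" where
  "real_matrix B = matrix_of (\<lambda>i j. of_int (B i j))"

text \<open>
  Both properties depend only on the lattice, not on the basis whose Gram matrix is \<open>A\<close>.
\<close>

lemma split_congruence:
  fixes A :: "real^'n::{finite,linorder}^'n::{finite,linorder}"
  assumes A: "pos_def_diagonalized A d"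
    and B: "unimodular CARD('n) B" "unimodular CARD('n) (\<lambda>i j. B j i)"
  shows "pos_def_diagonalized (real_matrix B ** A ** transpose (real_matrix B)) d"
proof -
  obtain W :: "real^'n::{finite,linorder}^'n::{finite,linorder}" where "real_matrix B ** W = mat 1"
    unfolding real_matrix_def by (rule unimodular_invertible[OF B(1)])
  then have "pos_def (real_matrix B ** A ** transpose (real_matrix B))"
    using A pos_def_congruence unfolding pos_def_diagonalized_def by blast
  moreover obtain P Q where PQ: "unimodular CARD('n) P" "unimodular CARD('n) Q"
      "A = matrix_of (\<lambda>i j. of_int (P i j) * d j) ** real_matrix Q"
    using A unfolding pos_def_diagonalized_def diagonalizes_iff real_matrix_def by blast
  have "diagonalizes (\<lambda>i j. \<Sum>k=1..CARD('n). B i k * P k j) d (\<lambda>i j. \<Sum>k=1..CARD('n). Q i k * B j k)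
      (real_matrix B ** A ** transpose (real_matrix B))"
    unfolding diagonalizes_iff
  proof (intro conjI unimodular_mult B PQ)
    have tr: "transpose (real_matrix B :: real^'n::{finite,linorder}^'n::{finite,linorder}) = real_matrix (\<lambda>i j. B j i)"
      by (simp add: real_matrix_def matrix_of_def transpose_def vec_eq_iff)
    have right: "(real_matrix Q :: real^'n::{finite,linorder}^'n::{finite,linorder}) ** transpose (real_matrix B) = real_matrix (\<lambda>i j. \<Sum>k=1..CARD('n). Q i k * B j k)"
      unfolding tr unfolding real_matrix_def matrix_of_mult by simp
    have left: "(real_matrix B :: real^'n::{finite,linorder}^'n::{finite,linorder}) ** matrix_of (\<lambda>i j. of_int (P i j) * d j) =
        matrix_of (\<lambda>i j. of_int (\<Sum>k=1..CARD('n). B i k * P k j) * d j)"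
      unfolding real_matrix_def matrix_of_mult by (simp add: sum_distrib_right mult.assoc)
    have "real_matrix B ** A ** transpose (real_matrix B) =
        (real_matrix B ** matrix_of (\<lambda>i j. of_int (P i j) * d j)) ** (real_matrix Q ** transpose (real_matrix B))"
      unfolding PQ(3) by (simp only: matrix_mul_assoc)
    then show "real_matrix B ** A ** transpose (real_matrix B) =
        matrix_of (\<lambda>i j. of_int (\<Sum>k=1..CARD('n). B i k * P k j) * d j) **
        matrix_of (\<lambda>i j. of_int (\<Sum>k=1..CARD('n). Q i k * B j k))"
      unfolding left right by (simp only: real_matrix_def)
  qed
  ultimately show ?thesis unfolding pos_def_diagonalized_def by blast
qed

text \<open>
  The Gram matrices for \<open>C\<^sub>n\<close> and \<open>D\<^sub>n\<close> come from the same lattice: the \<open>D\<^sub>n\<close> basis has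
  \<open>f\<^sub>n\<^sub>-\<^sub>1 - s = (e\<^sub>1 + \<dots> + e\<^sub>n\<^sub>-\<^sub>1 - e\<^sub>n) / 2\<close> in place of \<open>f\<^sub>n\<^sub>-\<^sub>1\<close>.
\<close>

lemma split_D:
  assumes n: "n = CARD('n)" and "n \<ge> 3"
    and C: "pos_def_diagonalized (matrix_of (last_halved n) :: real^'n::{finite,linorder}^'n::{finite,linorder}) d"
  shows "pos_def_diagonalized (Z0 (Dn n) :: real^'n::{finite,linorder}^'n::{finite,linorder}) d"
proof -
  define B :: "nat \<Rightarrow> nat \<Rightarrow> int" where "B i k = of_bool (i = k) - of_bool (i = n - 1 \<and> k = n)" for i k
  let ?B = "matrix_of (\<lambda>i j. of_int (B i j)) :: real^'n::{finite,linorder}^'n::{finite,linorder}"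
  have B_sum: "(\<Sum>k=1..n. of_int (B i k) * g k) = g i - (if i = n - 1 then g n else 0)"
    if "i \<in> {1..n}" for i and g :: "nat \<Rightarrow> real"
  proof -
    have "(\<Sum>k=1..n. of_int (B i k) * g k) =
        (\<Sum>k=1..n. (if k = i then g i else 0) - (if k = n then (if i = n - 1 then g n else 0) else 0))"
      by (intro sum.cong) (auto simp: B_def)
    also have "\<dots> = g i - (if i = n - 1 then g n else 0)"
      using that by (simp add: sum_subtractf)
    finally show ?thesis .
  qed
  have "transpose ?B = matrix_of (\<lambda>i j. of_int (B j i))"
    by (simp add: matrix_of_def transpose_def vec_eq_iff)
  then have "?B ** matrix_of (last_halved n) ** transpose ?B =
      matrix_of (\<lambda>i j. \<Sum>l=1..n. (\<Sum>k=1..n. of_int (B i k) * last_halved n k l) * of_int (B j l))"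
    by (simp add: matrix_of_mult n)
  also have "\<dots> = matrix_of (\<lambda>i j. \<Sum>l=1..n. of_int (B j l) * (\<Sum>k=1..n. of_int (B i k) * last_halved n k l))"
    by (simp only: mult.commute)
  also have "\<dots> = Z0 (Dn n)"
    unfolding Z0.simps
  proof (rule matrix_of_cong)
    show "(\<Sum>l=1..n. of_int (B j l) * (\<Sum>k=1..n. of_int (B i k) * last_halved n k l)) =
        symmetrize (\<lambda>i j. if j \<le> n - 2 then real i else if i \<le> n - 2 then real i / 2
          else if i = j then real n / 4 else (real n - 2) / 4) i j"
      if "i \<in> {1..CARD('n)}" "j \<in> {1..CARD('n)}" for i j
    proof -
      have ij: "i \<in> {1..n}" "j \<in> {1..n}" using that unfolding n .
      have cases: "(i \<le> n - 2 \<and> i < n - 1 \<and> i < n) \<or> (i = n - 1 \<and> i < n \<and> \<not> i \<le> n - 2) \<or> (i = n \<and> n - 1 < i \<and> \<not> i \<le> n - 2)"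
        if "i \<in> {1..n}" for i
        using that \<open>n \<ge> 3\<close> by auto
      show ?thesis
        unfolding B_sum[OF ij(1)] B_sum[OF ij(2)]
        using cases[OF ij(1)] cases[OF ij(2)] \<open>n \<ge> 3\<close>
        by (elim disjE conjE)
           (auto simp: last_halved_def symmetrize_def min_def max_def of_nat_diff field_simps)
    qed
  qed
  finally have "?B ** matrix_of (last_halved n) ** transpose ?B = Z0 (Dn n)" .
  moreover have "unimodular CARD('n) B"
    unfolding n[symmetric] by (rule unimodular_upper_triangular) (use \<open>n \<ge> 3\<close> in \<open>auto simp: B_def\<close>)
  moreover have "unimodular CARD('n) (\<lambda>i j. B j i)"
    unfolding n[symmetric] by (rule unimodular_lower_triangular) (use \<open>n \<ge> 3\<close> in \<open>auto simp: B_def\<close>)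
  ultimately show ?thesis using split_congruence[OF C, of B] by (simp add: real_matrix_def)
qed

section \<open>The exceptional root systems\<close>

lemma intervals:
  "{1..2::nat} = {1, 2}" "{1..4::nat} = {1, 2, 3, 4}" "{1..6::nat} = {1, 2, 3, 4, 5, 6}"
  "{1..7::nat} = {1, 2, 3, 4, 5, 6, 7}" "{1..8::nat} = {1, 2, 3, 4, 5, 6, 7, 8}"
  by auto

text \<open>
  The squares are completed from the leaves of the Dynkin diagram along its edges.
\<close>

lemma cartan_E_form:
  "(\<Sum>i=1..8. \<Sum>j=1..8. x i * cartan_E i j * x j) =
    2 * (x 1 - x 3 / 2)\<^sup>2 + 2 * (x 2 - x 4 / 2)\<^sup>2 + 3/2 * (x 3 - 2/3 * x 4)\<^sup>2 +
    5/6 * (x 4 - 6/5 * x 5)\<^sup>2 + 4/5 * (x 5 - 5/4 * x 6)\<^sup>2 + 3/4 * (x 6 - 4/3 * x 7)\<^sup>2 +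
    2/3 * (x 7 - 3/2 * x 8)\<^sup>2 + 1/2 * (x 8)\<^sup>2"
  unfolding intervals by (simp add: cartan_E_def symmetrize_def power2_eq_square algebra_simps)

text \<open>
  The smaller matrices are leading blocks of the largest one, so their forms are obtained by
  setting the last coordinates to zero.
\<close>

lemma pos_def_cartan_E:
  assumes "CARD('n) \<le> 8"
  shows "pos_def (matrix_of cartan_E :: real^'n::{finite,linorder}^'n::{finite,linorder})"
proof (rule pos_def_matrix_ofI)
  show "cartan_E i j = cartan_E j i" for i j
    by (simp add: cartan_E_def symmetrize_def min.commute max.commute)
  fix x :: "nat \<Rightarrow> real" assume "\<exists>i\<in>{1..CARD('n)}. x i \<noteq> 0"
  then obtain i where i: "i \<in> {1..CARD('n)}" "x i \<noteq> 0" by blast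
  define y where "y k = (if k \<le> CARD('n) then x k else 0)" for k
  let ?q = "\<Sum>i=1..8. \<Sum>j=1..8. y i * cartan_E i j * y j"
  have "(\<Sum>j=1..CARD('n). x i * cartan_E i j * x j) = (\<Sum>j=1..8. x i * cartan_E i j * y j)" for i
    using assms by (intro sum.mono_neutral_cong_left) (auto simp: y_def)
  then have "(\<Sum>i=1..CARD('n). \<Sum>j=1..CARD('n). x i * cartan_E i j * x j) =
      (\<Sum>i=1..CARD('n). \<Sum>j=1..8. x i * cartan_E i j * y j)" by simp
  also have "\<dots> = ?q"
    using assms by (intro sum.mono_neutral_cong_left) (auto simp: y_def)
  also have "0 < ?q"
  proof -
    have "0 \<le> ?q" unfolding cartan_E_form by simp
    moreover have "?q \<noteq> 0"
    proof
      assume "?q = 0"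
      then have "y 8 = 0 \<and> y 7 - 3/2 * y 8 = 0 \<and> y 6 - 4/3 * y 7 = 0 \<and> y 5 - 5/4 * y 6 = 0 \<and>
          y 4 - 6/5 * y 5 = 0 \<and> y 3 - 2/3 * y 4 = 0 \<and> y 2 - y 4 / 2 = 0 \<and> y 1 - y 3 / 2 = 0"
        unfolding cartan_E_form by (simp add: add_nonneg_eq_0_iff)
      then have "\<forall>k\<in>{1..8}. y k = 0" unfolding intervals by simp
      moreover have "i \<in> {1..8}" "y i = x i" using i assms by (auto simp: y_def)
      ultimately show False using i by metis
    qed
    ultimately show ?thesis by simp
  qed
  finally show "0 < (\<Sum>i=1..CARD('n). \<Sum>j=1..CARD('n). x i * cartan_E i j * x j)" .
qed

text \<open>
  In terms of the simple roots, the first \<open>n\<close> of these numbers are \<open>9 - n\<close> times the last fundamental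
  weight of \<open>E\<^sub>n\<close>: the Cartan matrix \<open>C\<close> maps them to \<open>(9 - n) e\<^sub>n\<close>.
\<close>

definition last_weight_E :: "nat \<Rightarrow> int" where
  "last_weight_E i = [2, 3, 4, 6, 5, 4, 3, 2] ! (i - 1)"

text \<open>
  The inverse of the matrix with columns \<open>C e\<^sub>1, \<dots>, C e\<^sub>n\<^sub>-\<^sub>1, e\<^sub>n\<^sub>-\<^sub>1 - e\<^sub>n\<close>. For
  \<open>n = 6, 7, 8\<close> its last row is \<open>last_weight_E\<close>, and the others are initial segments of fixed rows.
\<close>

definition coordinates_E :: "nat \<Rightarrow> nat \<Rightarrow> nat \<Rightarrow> int" where
  "coordinates_E n i j = (if i < n then - ([
      [0, 1, 1, 2, 2, 2, 2, 2],
      [1, 1, 2, 3, 3, 3, 3, 3],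
      [1, 2, 2, 4, 4, 4, 4, 4],
      [2, 3, 4, 6, 6, 6, 6, 6],
      [2, 3, 4, 6, 5, 5, 5, 5],
      [2, 3, 4, 6, 5, 4, 4, 4],
      [2, 3, 4, 6, 5, 4, 3, 3]] ! (i - 1) ! (j - 1))
    else last_weight_E j)"

lemma matrix_inv_eq:
  fixes A B :: "real^'n^'n"
  assumes "A ** B = mat 1"
  shows "matrix_inv A = B"
proof -
  have "B ** A = mat 1" using assms by (rule matrix_left_right_inverse[THEN iffD1])
  with assms show ?thesis
    unfolding matrix_inv_def
    by (intro some_equality) (auto, metis matrix_mul_assoc matrix_mul_lid matrix_mul_rid)
qed

text \<open>
  If \<open>r\<close> is the vector of \<open>last_weight_E\<close>, then \<open>r - (9 - n) e\<^sub>n\<close> is integral with last entry 1, and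
  \<open>C\<close> maps it to \<open>(9 - n) (e\<^sub>n\<^sub>-\<^sub>1 - e\<^sub>n)\<close>. With this vector as the last column of \<open>P\<close> and unit vectors as the
  others, \<open>C P D\<close> is therefore the matrix inverse to \<open>Q\<close>, and \<open>C\<^sup>-\<^sup>1 = P D Q\<close>.
\<close>

lemma split_E:
  assumes n: "CARD('n) = n" and "n = 6 \<or> n = 7 \<or> n = 8"
  shows "pos_def_diagonalized (matrix_inv (matrix_of cartan_E) :: real^'n::{finite,linorder}^'n::{finite,linorder})
    (\<lambda>k. if k < n then 1 else 1 / (9 - real n))"
proof -
  let ?d = "\<lambda>k. if k < n then 1 else 1 / (9 - real n)"
  let ?P = "bordered (n - 1) (\<lambda>i j. if i < n then last_weight_E i else 1)"
  let ?C = "matrix_of cartan_E :: real^'n::{finite,linorder}^'n::{finite,linorder}"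
  let ?T = "\<lambda>i j. if j < n then \<lfloor>cartan_E i j\<rfloor> else of_bool (i = n - 1) - of_bool (i = n)"
  let ?PD = "matrix_of (\<lambda>i j. of_int (?P i j) * ?d j) :: real^'n::{finite,linorder}^'n::{finite,linorder}"
  let ?Qm = "matrix_of (\<lambda>i j. of_int (coordinates_E n i j)) :: real^'n::{finite,linorder}^'n::{finite,linorder}"
  let ?Tm = "matrix_of (\<lambda>i j. of_int (?T i j)) :: real^'n::{finite,linorder}^'n::{finite,linorder}"
  have floor: "\<lfloor>- 1 :: real\<rfloor> = - 1" by linarith
  have QT: "\<forall>i\<in>{1..n}. \<forall>j\<in>{1..n}. (\<Sum>k=1..n. coordinates_E n i k * ?T k j) = of_bool (i = j)"
    using assms(2)
    by (elim disjE; hypsubst; unfold intervals; simp add: floor coordinates_E_def last_weight_E_def cartan_E_def symmetrize_def)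
  have "\<forall>i\<in>{1..n}. \<forall>j\<in>{1..n}. (\<Sum>k=1..n. cartan_E i k * (of_int (?P k j) * ?d j)) = of_int (?T i j)"
    using assms(2)
    by (elim disjE; hypsubst; unfold intervals; simp add: floor bordered_def last_weight_E_def cartan_E_def symmetrize_def)
  then have CPD: "?C ** ?PD = ?Tm"
    unfolding matrix_of_mult n by (intro matrix_of_cong) (simp add: n)
  have "?Qm ** ?Tm = matrix_of (\<lambda>i j. of_bool (i = j))"
    unfolding matrix_of_mult n
  proof (rule matrix_of_cong)
    fix i j assume "i \<in> {1..CARD('n)}" "j \<in> {1..CARD('n)}"
    then have "of_int (\<Sum>k=1..n. coordinates_E n i k * ?T k j) = (of_bool (i = j) :: real)"
      using QT n by simp
    then show "(\<Sum>k=1..n. of_int (coordinates_E n i k) * of_int (?T k j)) = (of_bool (i = j) :: real)"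
      by (simp only: of_int_sum of_int_mult)
  qed
  also have "\<dots> = mat 1"
    by (simp add: matrix_of_def mat_def vec_eq_iff pos_inject)
  finally have "?Tm ** ?Qm = mat 1"
    by (rule matrix_left_right_inverse[THEN iffD1])
  then have inverse: "?C ** (?PD ** ?Qm) = mat 1"
    by (simp only: matrix_mul_assoc CPD)
  then have inv: "matrix_inv ?C = ?PD ** ?Qm"
    by (rule matrix_inv_eq)
  have "pos_def (matrix_inv ?C)"
    unfolding inv by (rule pos_def_inverse[OF pos_def_cartan_E inverse]) (use assms in auto)
  moreover have "diagonalizes ?P ?d (coordinates_E n) (matrix_inv ?C)"
    unfolding diagonalizes_iff n
  proof (intro conjI inv)
    show "unimodular n ?P"
      by (rule unimodular_upper_triangular) (auto simp: bordered_def)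
    show "unimodular n (coordinates_E n)"
      by (rule unimodular_right_inverse[where P' = ?T]) (use QT in blast)
  qed
  ultimately show ?thesis unfolding pos_def_diagonalized_def by blast
qed

text \<open>
  The last two rows of the matrix and the doubles of the first two form a basis of \<open>\<int>\<^sup>4\<close>; \<open>Q\<close> has
  these rows, and the permutation \<open>P\<close> restores their original order.
\<close>

lemma split_F4:
  assumes n: "CARD('n) = 4"
  shows "pos_def_diagonalized (Z0 F4 :: real^'n::{finite,linorder}^'n::{finite,linorder}) (\<lambda>k. if k \<le> 2 then 1 else 1 / 2)"
proof -
  let ?Z = "\<lambda>i j. matrix_F4 ! (i - 1) ! (j - 1)"
  let ?P = "\<lambda>i j. of_bool ((i, j) \<in> {(1, 3), (2, 4), (3, 1), (4, 2)})"
  let ?Q = "\<lambda>i j. [[2, 4, 6, 3], [1, 2, 3, 2], [2, 3, 4, 2], [3, 6, 8, 4]] ! (i - 1) ! (j - 1) :: int"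
  let ?Q' = "\<lambda>i j. [[0, 0, 2, -1], [-2, 0, -1, 2], [2, -1, 0, -1], [-1, 2, 0, 0]] ! (i - 1) ! (j - 1) :: int"
  have "pos_def (matrix_of ?Z :: real^'n::{finite,linorder}^'n::{finite,linorder})"
  proof (rule pos_def_matrix_ofI)
    show "?Z i j = ?Z j i" if "i \<in> {1..CARD('n)}" "j \<in> {1..CARD('n)}" for i j
      using that unfolding n intervals by (auto simp: matrix_F4_def)
    fix x :: "nat \<Rightarrow> real" assume x: "\<exists>i\<in>{1..CARD('n)}. x i \<noteq> 0"
    have q: "(\<Sum>i=1..CARD('n). \<Sum>j=1..CARD('n). x i * ?Z i j * x j) =
        (x 1 + 3/2 * x 2 + 2 * x 3 + x 4)\<^sup>2 + 3/4 * (x 2 + 4/3 * x 3 + 2/3 * x 4)\<^sup>2 +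
        2/3 * (x 3 + x 4 / 2)\<^sup>2 + 1/2 * (x 4)\<^sup>2" (is "_ = ?q")
      unfolding n intervals by (simp add: matrix_F4_def power2_eq_square algebra_simps)
    have "0 \<noteq> ?q"
    proof
      assume "0 = ?q"
      then have "x 4 = 0 \<and> x 3 + x 4 / 2 = 0 \<and> x 2 + 4/3 * x 3 + 2/3 * x 4 = 0 \<and>
          x 1 + 3/2 * x 2 + 2 * x 3 + x 4 = 0"
        by (subst (asm) eq_commute) (simp add: add_nonneg_eq_0_iff)
      then show False using x unfolding n intervals by auto
    qed
    moreover have "0 \<le> ?q" by simp
    ultimately show "0 < (\<Sum>i=1..CARD('n). \<Sum>j=1..CARD('n). x i * ?Z i j * x j)"
      unfolding q by (rule order_le_neq_trans[rotated])
  qed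
  moreover have "diagonalizes ?P (\<lambda>k. if k \<le> 2 then 1 else 1 / 2) ?Q
      (matrix_of ?Z :: real^'n::{finite,linorder}^'n::{finite,linorder})"
  proof (rule diagonalizesI)
    show "unimodular CARD('n) ?P"
      by (rule unimodular_right_inverse[of _ _ ?P]) (unfold n intervals, auto)
    show "unimodular CARD('n) ?Q"
      by (rule unimodular_right_inverse[of _ _ ?Q']) (unfold n intervals, auto)
    show "(\<Sum>k=1..CARD('n). of_int (?P i k) * (if k \<le> 2 then 1 else 1 / 2) * of_int (?Q k j)) = ?Z i j"
      if "i \<in> {1..CARD('n)}" "j \<in> {1..CARD('n)}" for i j
      using that unfolding n intervals by (auto simp: matrix_F4_def)
  qed
  ultimately show ?thesis unfolding pos_def_diagonalized_def by auto
qed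

text \<open>
  The first row and three times the second row form a basis of \<open>\<int>\<^sup>2\<close>, so \<open>P\<close> is the identity.
\<close>

lemma split_G2:
  assumes n: "CARD('n) = 2"
  shows "pos_def_diagonalized (Z0 G2 :: real^'n::{finite,linorder}^'n::{finite,linorder}) (\<lambda>k. if k = 1 then 1 else 1 / 3)"
proof -
  let ?Z = "\<lambda>i j. matrix_G2 ! (i - 1) ! (j - 1)"
  let ?P = "\<lambda>i j. of_bool (i = j)"
  let ?Q = "\<lambda>i j. [[2, 1], [3, 2]] ! (i - 1) ! (j - 1) :: int"
  let ?Q' = "\<lambda>i j. [[2, -1], [-3, 2]] ! (i - 1) ! (j - 1) :: int"
  have "pos_def (matrix_of ?Z :: real^'n::{finite,linorder}^'n::{finite,linorder})"
  proof (rule pos_def_matrix_ofI)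
    show "?Z i j = ?Z j i" if "i \<in> {1..CARD('n)}" "j \<in> {1..CARD('n)}" for i j
      using that unfolding n intervals by (auto simp: matrix_G2_def)
    fix x :: "nat \<Rightarrow> real" assume x: "\<exists>i\<in>{1..CARD('n)}. x i \<noteq> 0"
    have q: "(\<Sum>i=1..CARD('n). \<Sum>j=1..CARD('n). x i * ?Z i j * x j) =
        2 * (x 1 + x 2 / 2)\<^sup>2 + 1/6 * (x 2)\<^sup>2" (is "_ = ?q")
      unfolding n intervals by (simp add: matrix_G2_def power2_eq_square algebra_simps)
    have "0 \<noteq> ?q"
    proof
      assume "0 = ?q"
      then have "x 2 = 0 \<and> x 1 + x 2 / 2 = 0"
        by (subst (asm) eq_commute) (simp add: add_nonneg_eq_0_iff)
      then show False using x unfolding n intervals by auto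
    qed
    moreover have "0 \<le> ?q" by simp
    ultimately show "0 < (\<Sum>i=1..CARD('n). \<Sum>j=1..CARD('n). x i * ?Z i j * x j)"
      unfolding q by (rule order_le_neq_trans[rotated])
  qed
  moreover have "diagonalizes ?P (\<lambda>k. if k = 1 then 1 else 1 / 3) ?Q
      (matrix_of ?Z :: real^'n::{finite,linorder}^'n::{finite,linorder})"
  proof (rule diagonalizesI)
    show "unimodular CARD('n) ?P"
      by (rule unimodular_lower_triangular) auto
    show "unimodular CARD('n) ?Q"
      by (rule unimodular_right_inverse[of _ _ ?Q']) (unfold n intervals, auto)
    show "(\<Sum>k=1..CARD('n). of_int (?P i k) * (if k = 1 then 1 else 1 / 3) * of_int (?Q k j)) = ?Z i j"
      if "i \<in> {1..CARD('n)}" "j \<in> {1..CARD('n)}" for i j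
      using that unfolding n intervals by (auto simp: matrix_G2_def)
  qed
  ultimately show ?thesis unfolding pos_def_diagonalized_def by auto
qed

section \<open>The decomposition\<close>

lemma split_Z0:
  assumes "valid_root_system R" "root_system_dim R = CARD('n)"
  obtains d where "pos_def_diagonalized (Z0 R :: real^'n::{finite,linorder}^'n::{finite,linorder}) d"
    and "\<And>k \<tau>. k \<in> {1..CARD('n)} \<Longrightarrow> elliptic_moduli R \<tau> ! (k - 1) = \<tau> * of_real (d k)"
proof -
  have even_odd: "\<exists>d. pos_def_diagonalized (matrix_of (last_halved m) :: real^'n::{finite,linorder}^'n::{finite,linorder}) d \<and>
      (\<forall>k\<in>{1..CARD('n)}. \<forall>\<tau> :: complex. (if odd m then replicate (m - 1) \<tau> @ [\<tau> / 4]
        else replicate (m - 2) \<tau> @ [\<tau> / 2, \<tau> / 2]) ! (k - 1) = \<tau> * of_real (d k))"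
    if "m = CARD('n)" "m \<ge> 3" for m
  proof (cases "odd m")
    case True
    then show ?thesis
      using that by (intro exI[of _ "\<lambda>k. if k < m then 1 else 1 / 4"] conjI split_last_halved_odd)
        (auto simp: nth_append)
  next
    case False
    have "(replicate (m - 2) \<tau> @ [\<tau> / 2, \<tau> / 2]) ! (k - 1) = (if k < m - 1 then \<tau> else \<tau> / 2)"
      if "k \<in> {1..m}" for k and \<tau> :: complex
    proof -
      have "k < m - 1 \<or> k = m - 1 \<or> k = m" using that by auto
      then show ?thesis using that \<open>m \<ge> 3\<close> by (auto simp: nth_append)
    qed
    with False show ?thesis
      using that by (intro exI[of _ "\<lambda>k. if k < m - 1 then 1 else 1 / 2"] conjI split_last_halved_even) auto
  qed
  have "\<exists>d. pos_def_diagonalized (Z0 R :: real^'n::{finite,linorder}^'n::{finite,linorder}) d \<and>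
      (\<forall>k\<in>{1..CARD('n)}. \<forall>\<tau>. elliptic_moduli R \<tau> ! (k - 1) = \<tau> * of_real (d k))"
  proof (cases R)
    case (An m)
    then show ?thesis
      using assms by (intro exI[of _ "\<lambda>k. if k < m then 1 else 1 / real (m + 1)"] conjI)
        (auto simp: nth_append simp del: Z0.simps intro: split_A)
  next
    case (Bn m)
    then show ?thesis
      using assms by (intro exI[of _ "\<lambda>k. 1"] conjI) (auto simp del: Z0.simps intro: split_B)
  next
    case (Cn m)
    then have m: "m = CARD('n)" "m \<ge> 3" using assms by auto
    show ?thesis
      unfolding Cn Z0_C[OF m(1)] elliptic_moduli.simps using even_odd[OF m] .
  next
    case (Dn m)
    then have m: "m = CARD('n)" "m \<ge> 3" using assms by auto
    show ?thesis
      unfolding Dn elliptic_moduli.simps using even_odd[OF m] split_D[OF m] by blast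
  next
    case E6
    then show ?thesis
      using assms split_E[where 'n = 'n, of 6]
      by (intro exI[of _ "\<lambda>k. if k < 6 then 1 else 1 / (9 - real 6)"] conjI) (auto simp: nth_append)
  next
    case E7
    then show ?thesis
      using assms split_E[where 'n = 'n, of 7]
      by (intro exI[of _ "\<lambda>k. if k < 7 then 1 else 1 / (9 - real 7)"] conjI) (auto simp: nth_append)
  next
    case E8
    then show ?thesis
      using assms split_E[where 'n = 'n, of 8]
      by (intro exI[of _ "\<lambda>k. if k < 8 then 1 else 1 / (9 - real 8)"] conjI) (auto simp: nth_append)
  next
    case F4
    then have n: "CARD('n) = 4" using assms by simp
    show ?thesis
      using split_F4[OF n] unfolding F4 n intervals
      by (intro exI[of _ "\<lambda>k. if k \<le> 2 then 1 else 1 / 2"] conjI) auto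
  next
    case G2
    then have n: "CARD('n) = 2" using assms by simp
    show ?thesis
      using split_G2[OF n] unfolding G2 n intervals
      by (intro exI[of _ "\<lambda>k. if k = 1 then 1 else 1 / 3"] conjI) auto
  qed
  then show ?thesis using that by blast
qed

theorem proposition4p1:
  fixes R :: root_system and \<tau> :: complex
    and Z :: "complex^'n::{finite,linorder}^'n::{finite,linorder}"
  assumes "valid_root_system R"
    and "root_system_dim R = CARD('n)"
    and "Im \<tau> > 0"
    and "Z = riemann_matrix R \<tau>"
  shows "Z \<in> siegel_upper_half_space \<and>
    isomorphic_tori (ppav_of Z)
      (product_of_elliptic_curves (elliptic_moduli R \<tau>)
        :: ((complex, 'n) vec, 'n \<Rightarrow> complex set) complex_torus)"
proof -
  obtain d where d: "pos_def_diagonalized (Z0 R :: real^'n::{finite,linorder}^'n::{finite,linorder}) d"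
    and moduli: "\<And>k. k \<in> {1..CARD('n)} \<Longrightarrow> elliptic_moduli R \<tau> ! (k - 1) = \<tau> * of_real (d k)"
    using split_Z0[OF assms(1,2)] by metis
  have Z: "Z = (\<chi> i j. \<tau> * of_real (Z0 R $ i $ j))"
    using assms(4) by (simp add: riemann_matrix_def)
  from d show ?thesis
    unfolding pos_def_diagonalized_def
    using pos_def_imp_siegel[OF _ assms(3)] isomorphic_tori_of_diagonalizes[OF _ Z moduli]
    unfolding Z by blast
qed

end
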